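(* Let $\mu$ be a probability distribution on $\mathbb{R}^{n\times n}$ with bounded support, let $\mathcal M=\operatorname{supp}\mu$, and let $A$ be a random matrix with distribution $\mu$. Assume that (i) there is a proper cone $K\subset\mathbb{R}^n$ such that $MK\subset K$ for every $M\in\mathcal M$; and (ii) the singular part $\mu_s$ of $\mu$ with respect to Lebesgue measure on $\mathbb{R}^{n\times n}$ is either $0$ or of the form $\mu_s=p_1\delta_{M_1}+\cdots+p_N\delta_{M_N}$ for some finite $N$, positive numbers $p_1,\dots,p_N$ and matrices $M_1,\dots,M_N\in\mathbb{R}^{n\times n}$. Then $$\hat\rho(\mathcal M)=\lim_{p\to\infty}\rho\left(E[A^{\otimes p}]\right)^{1/p},$$ where the limit is over positive integers $p$.
   Context: A cone in $\mathbb{R}^n$ is a subset closed under multiplication by nonnegative numbers; it is proper if it is closed, convex, has nonempty interior, and is pointed ($x,-x\in K$ implies $x=0$). For a bounded set $\mathcal M\subset\mathbb{R}^{n\times n}$, the joint spectral radius is $\hat\rho(\mathcal M)=\limsup_{k\to\infty}\sup_{A_1,\dots,A_k\in\mathcal M}\|A_k\cdots A_1\|^{1/k}$, with $\|\cdot\|$ the maximal singular value. $\rho(\cdot)$ is the spectral radius of a square matrix. $A^{\otimes p}$ is the $p$-fold Kronecker power: $A^{\otimes 1}=A$, $A^{\otimes p}=A^{\otimes(p-1)}\otimes A$. $\delta_M$ denotes the Dirac measure at $M$. *)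

theory Defs
  imports "HOL-Probability.Probability" "Jordan_Normal_Form.Spectral_Radius"
begin

hide_const (open) Matrix.mat Matrix.vec Matrix.orthogonal
no_notation Matrix.vec_index (infixl \<open>$\<close> 100)
no_notation Matrix.scalar_prod (infix \<open>\<bullet>\<close> 70)

definition proper_cone :: "(real ^ 'n) set \<Rightarrow> bool" where
  "proper_cone K \<longleftrightarrow>
     cone K \<and> closed K \<and> convex K \<and> interior K \<noteq> {} \<and> (\<forall>x. x \<in> K \<and> - x \<in> K \<longrightarrow> x = 0)"

section \<open>Joint spectral radius\<close>

definition singular_values :: "real ^ 'n ^ 'n \<Rightarrow> real set" where
  "singular_values A = {s. 0 \<le> s \<and> (\<exists>v. v \<noteq> 0 \<and> (transpose A ** A) *v v = s\<^sup>2 *\<^sub>R v)}"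

definition max_singular_value :: "real ^ 'n ^ 'n \<Rightarrow> real" where
  "max_singular_value A = Max (singular_values A)"

lemma inner_gram: "((transpose A ** A) *v x) \<bullet> y = (A *v x) \<bullet> (A *v y)"
  for A :: "real ^ 'n ^ 'n"
  by (metis dot_lmul_matrix inner_commute matrix_vector_mul_assoc transpose_matrix_vector)

lemma finite_singular_values: "finite (singular_values A)"
  for A :: "real ^ 'n ^ 'n"
proof -
  let ?B = "transpose A ** A"
  have "\<forall>s. \<exists>v. s \<in> singular_values A \<longrightarrow> v \<noteq> 0 \<and> ?B *v v = s\<^sup>2 *\<^sub>R v"
    by (auto simp: singular_values_def)
  then obtain f where f: "\<And>s. s \<in> singular_values A \<Longrightarrow> f s \<noteq> 0 \<and> ?B *v f s = s\<^sup>2 *\<^sub>R f s"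
    by metis
  have orth: "f s \<bullet> f t = 0" if "s \<in> singular_values A" "t \<in> singular_values A" "s \<noteq> t" for s t
  proof -
    have "s\<^sup>2 * (f s \<bullet> f t) = (A *v f s) \<bullet> (A *v f t)"
      using inner_gram[of A "f s" "f t"] f[OF that(1)] by simp
    also have "\<dots> = t\<^sup>2 * (f s \<bullet> f t)"
      using inner_gram[of A "f t" "f s"] f[OF that(2)] by (simp add: inner_commute)
    finally have "s\<^sup>2 = t\<^sup>2 \<or> f s \<bullet> f t = 0" by auto
    moreover have "s\<^sup>2 \<noteq> t\<^sup>2"
      using that by (auto simp: singular_values_def power2_eq_iff_nonneg)
    ultimately show ?thesis by blast
  qed
  have "inj_on f (singular_values A)"
    by (rule inj_onI) (metis f inner_eq_zero_iff orth)
  moreover have "pairwise orthogonal (f ` singular_values A)"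
    by (auto simp: pairwise_def Linear_Algebra.orthogonal_def) (metis orth)
  ultimately show ?thesis
    using pairwise_orthogonal_imp_finite finite_imageD by blast
qed

lemma quadratic_nonneg_linear_zero:
  fixes a b :: real
  assumes "\<And>t. 0 \<le> t * b + t\<^sup>2 * a"
  shows "b = 0"
proof (rule ccontr)
  assume b: "b \<noteq> 0"
  define c where "c = \<bar>a\<bar> + 1"
  have c: "c > 0" "a < c" by (auto simp: c_def)
  have "(- b / c) * b + (- b / c)\<^sup>2 * a = (b\<^sup>2 / c\<^sup>2) * (a - c)"
    using c by (simp add: field_simps power2_eq_square)
  moreover have "(b\<^sup>2 / c\<^sup>2) * (a - c) < 0"
    using b c by (intro mult_pos_neg) auto
  ultimately show False using assms[of "- b / c"] by linarith
qed

lemma max_singular_value_eq_onorm: "max_singular_value A = onorm ((*v) A)"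
  for A :: "real ^ 'n ^ 'n"
proof -
  let ?s = "onorm ((*v) A)"
  have bl: "bounded_linear ((*v) A)" by (rule matrix_vector_mul_bounded_linear)
  have "continuous_on (sphere 0 1) (\<lambda>x. norm (A *v x))"
    by (intro continuous_intros linear_continuous_on bl)
  moreover have "sphere (0 :: real ^ 'n) 1 \<noteq> {}" by simp
  ultimately obtain v where v: "v \<in> sphere 0 1"
    and vmax: "\<And>x. x \<in> sphere 0 1 \<Longrightarrow> norm (A *v x) \<le> norm (A *v v)"
    using continuous_attains_sup[of "sphere 0 1" "\<lambda>x. norm (A *v x)"] compact_sphere by metis
  have nv: "norm v = 1" using v by simp
  have "norm (A *v x) \<le> norm (A *v v) * norm x" for x
  proof (cases "x = 0")
    case False
    have "norm (A *v ((1 / norm x) *\<^sub>R x)) \<le> norm (A *v v)"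
      using False by (intro vmax) simp
    then show ?thesis
      using False by (simp add: linear_scale[OF matrix_vector_mul_linear] field_simps)
  qed simp
  then have "?s \<le> norm (A *v v)"
    by (intro onorm_le)
  then have sv: "norm (A *v v) = ?s"
    using onorm[OF bl, of v] nv by simp
  have s0: "0 \<le> ?s" by (rule onorm_pos_le[OF bl])
  have crit: "(?s\<^sup>2 *\<^sub>R v - (transpose A ** A) *v v) \<bullet> w = 0" for w
  proof -
    have *: "0 \<le> t * (2 * (?s\<^sup>2 * (v \<bullet> w) - (A *v v) \<bullet> (A *v w)))
        + t\<^sup>2 * (?s\<^sup>2 * (w \<bullet> w) - (A *v w) \<bullet> (A *v w))" for t
    proof -
      let ?u = "v + t *\<^sub>R w"
      have "(norm (A *v ?u))\<^sup>2 \<le> (?s * norm ?u)\<^sup>2"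
        by (intro power_mono onorm[OF bl]) simp
      then have "(A *v ?u) \<bullet> (A *v ?u) \<le> ?s\<^sup>2 * (?u \<bullet> ?u)"
        by (simp add: power_mult_distrib power2_norm_eq_inner)
      moreover have "A *v ?u = A *v v + t *\<^sub>R (A *v w)"
        by (simp add: matrix_vector_right_distrib linear_scale[OF matrix_vector_mul_linear])
      moreover have "(A *v v) \<bullet> (A *v v) = ?s\<^sup>2"
        using sv by (simp add: power2_norm_eq_inner[symmetric])
      moreover have "v \<bullet> v = 1"
        using nv by (simp add: power2_norm_eq_inner[symmetric])
      ultimately show ?thesis
        by (simp add: inner_left_distrib inner_right_distrib inner_commute algebra_simps
            power2_eq_square)
    qed
    have "2 * (?s\<^sup>2 * (v \<bullet> w) - (A *v v) \<bullet> (A *v w)) = 0"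
      using quadratic_nonneg_linear_zero[OF *] .
    then show ?thesis by (simp add: inner_diff_left inner_gram)
  qed
  have "(transpose A ** A) *v v = ?s\<^sup>2 *\<^sub>R v"
    using crit[of "?s\<^sup>2 *\<^sub>R v - (transpose A ** A) *v v"] by simp
  moreover have "v \<noteq> 0" using nv by auto
  ultimately have mem: "?s \<in> singular_values A"
    using s0 by (auto simp: singular_values_def)
  have ub: "s \<le> ?s" if s: "s \<in> singular_values A" for s
  proof -
    obtain u where u: "0 \<le> s" "u \<noteq> 0" "(transpose A ** A) *v u = s\<^sup>2 *\<^sub>R u"
      using s by (auto simp: singular_values_def)
    have "(norm (A *v u))\<^sup>2 = (s * norm u)\<^sup>2"
      using inner_gram[of A u u] u(3) by (simp add: power2_norm_eq_inner power_mult_distrib)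
    then have "norm (A *v u) = s * norm u"
      using u(1) by (simp add: power2_eq_iff_nonneg)
    then show ?thesis using onorm[OF bl, of u] u(2) by simp
  qed
  show ?thesis
    unfolding max_singular_value_def using finite_singular_values mem ub by (intro Max_eqI) auto
qed

text \<open>\<open>left_product A k\<close> is \<open>A\<^sub>k \<cdots> A\<^sub>1\<close>.\<close>

primrec left_product :: "(nat \<Rightarrow> real ^ 'n ^ 'n) \<Rightarrow> nat \<Rightarrow> real ^ 'n ^ 'n" where
  "left_product A 0 = mat 1"
| "left_product A (Suc k) = A (Suc k) ** left_product A k"

text \<open>The value is taken in the extended reals, where every supremum and limes superior exists;
  it is a finite nonnegative number when \<open>\<M>\<close> is bounded and nonempty.  The term \<open>k = 0\<close> is
  irrelevant to the limes superior.\<close>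

definition joint_spectral_radius :: "(real ^ 'n ^ 'n) set \<Rightarrow> ereal" where
  "joint_spectral_radius \<M> =
     limsup (\<lambda>k. SUP A \<in> {A. \<forall>i \<in> {1..k}. A i \<in> \<M>}.
       ereal (root k (max_singular_value (left_product A k))))"

section \<open>Support and singular part of a Borel measure\<close>

definition measure_support :: "'a :: topological_space measure \<Rightarrow> 'a set" where
  "measure_support \<mu> = {x. \<forall>U. open U \<and> x \<in> U \<longrightarrow> emeasure \<mu> U > 0}"

text \<open>\<open>lebesgue_decomposition \<nu> \<mu> \<mu>\<^sub>a \<mu>\<^sub>s\<close>: \<open>\<mu> = \<mu>\<^sub>a + \<mu>\<^sub>s\<close> with \<open>\<mu>\<^sub>a\<close> absolutely continuous and \<open>\<mu>\<^sub>s\<close>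
  singular with respect to \<open>\<nu>\<close>.  For \<open>\<sigma>\<close>-finite \<open>\<mu>\<close> and \<open>\<nu>\<close> such \<open>\<mu>\<^sub>a\<close> and \<open>\<mu>\<^sub>s\<close> exist and are unique.\<close>

definition lebesgue_decomposition ::
    "'a measure \<Rightarrow> 'a measure \<Rightarrow> 'a measure \<Rightarrow> 'a measure \<Rightarrow> bool" where
  "lebesgue_decomposition \<nu> \<mu> \<mu>\<^sub>a \<mu>\<^sub>s \<longleftrightarrow>
     sets \<mu> = sets \<nu> \<and> sets \<mu>\<^sub>a = sets \<nu> \<and> sets \<mu>\<^sub>s = sets \<nu> \<and>
     (\<forall>B \<in> sets \<nu>. emeasure \<mu> B = emeasure \<mu>\<^sub>a B + emeasure \<mu>\<^sub>s B) \<and>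
     absolutely_continuous \<nu> \<mu>\<^sub>a \<and>
     (\<exists>S \<in> sets \<nu>. emeasure \<nu> S = 0 \<and> emeasure \<mu>\<^sub>s (space \<nu> - S) = 0)"

section \<open>Kronecker powers and their expectation\<close>

text \<open>The sizes \<open>n\<^sup>p\<close> of the Kronecker powers vary with \<open>p\<close>, so these are matrices with explicit
  dimensions.  The index type \<open>'n\<close> is numbered by \<open>from_nat_into UNIV\<close>, a bijection from
  \<open>{..<CARD('n)}\<close>; another numbering would conjugate all matrices below by one permutation matrix,
  which leaves spectral radii unchanged.\<close>

definition to_mat :: "'a ^ 'n ^ 'n \<Rightarrow> 'a Matrix.mat" where
  "to_mat A = Matrix.mat CARD('n) CARD('n)
     (\<lambda>(i, j). A $ from_nat_into UNIV i $ from_nat_into UNIV j)"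

definition kronecker :: "'a :: times Matrix.mat \<Rightarrow> 'a Matrix.mat \<Rightarrow> 'a Matrix.mat" where
  "kronecker A B = Matrix.mat (dim_row A * dim_row B) (dim_col A * dim_col B)
     (\<lambda>(i, j). A $$ (i div dim_row B, j div dim_col B) * B $$ (i mod dim_row B, j mod dim_col B))"

primrec kronecker_power :: "'a :: semiring_1 Matrix.mat \<Rightarrow> nat \<Rightarrow> 'a Matrix.mat" where
  "kronecker_power A 0 = 1\<^sub>m 1"
| "kronecker_power A (Suc p) = kronecker (kronecker_power A p) A"

lemma kronecker_power_1: "kronecker_power A 1 = A"
  by (rule eq_matI) (auto simp: kronecker_def)

definition expectation_kronecker_power ::
    "'w measure \<Rightarrow> ('w \<Rightarrow> real ^ 'n ^ 'n) \<Rightarrow> nat \<Rightarrow> real Matrix.mat" where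
  "expectation_kronecker_power P A p = Matrix.mat (CARD('n) ^ p) (CARD('n) ^ p)
     (\<lambda>ij. \<integral>\<omega>. kronecker_power (to_mat (A \<omega>)) p $$ ij \<partial>P)"

end

(* Upper bound: for r above the joint spectral radius, the covectors f all of whose products
   f M_k ... M_1 have norm at most r^k form a bounded set F with nonempty interior that every
   M / r maps into itself.  Pairing an eigenvector of E[A^(x)p] with the decomposable tensors over
   F shows that its eigenvalue is at most r^p in modulus.

   Lower bound: if the spectral radius of E[A^(x)p] is below g^p and f is positive on K, then
   V x = sum_k g^(-pk) E <f, A_k ... A_1 x>^p is finite on K and E V(Ax) <= g^p V x.  It remains to
   bound V(Mx) by C g'^p V x for every M in the support, with g' arbitrarily close to g and C
   independent of p, since the joint spectral radius is then at most C^(1/p) g'.  For finitely many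
   atoms this is immediate.  Otherwise the absolutely continuous part charges the interior of the
   convex set of matrices preserving K (its frontier is a null set).  A support point M0 there sends
   x to a vector above a multiple of |x| e, so V x is bounded below by a multiple of V e |x|^p,
   uniformly in p up to p-th powers.  Hence V(Mx) may be compared with V(M'x) for M' in a ball
   around M whose radius does not depend on p, and the masses of these balls are bounded below by
   compactness of the support. *)

theory Submission
  imports Defs
begin

section \<open>Kronecker powers and decomposable tensors\<close>

text \<open>Entries of the Kronecker power, each factor being read off one base-n digit of
  \<open>i\<close> and \<open>j\<close>. The function is total in the indices, so the recursion
  carries no range conditions.\<close>

primrec kron_entry :: "real ^ 'n ^ 'n \<Rightarrow> nat \<Rightarrow> nat \<Rightarrow> nat \<Rightarrow> real" where
  "kron_entry M 0 i j = 1"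
| "kron_entry M (Suc p) i j = kron_entry M p (i div CARD('n)) (j div CARD('n)) *
     M $ from_nat_into UNIV (i mod CARD('n)) $ from_nat_into UNIV (j mod CARD('n))"

text \<open>Coordinates of the decomposable tensor with factors \<open>f 0\<close>, ...,
  \<open>f (p - 1)\<close>; the last factor owns the lowest digit, as in
  \<open>kronecker_power\<close>. The factors may differ, so that basis tensors are
  included.\<close>

primrec tensor :: "(nat \<Rightarrow> real ^ 'n) \<Rightarrow> nat \<Rightarrow> nat \<Rightarrow> real" where
  "tensor f 0 i = 1"
| "tensor f (Suc p) i =
     tensor f p (i div CARD('n)) * f p $ from_nat_into UNIV (i mod CARD('n))"

lemma dim_kronecker_power_to_mat:
  fixes M :: "real ^ 'n ^ 'n"
  shows "dim_row (kronecker_power (to_mat M) p) = CARD('n) ^ p"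
    and "dim_col (kronecker_power (to_mat M) p) = CARD('n) ^ p"
  by (induction p) (auto simp: kronecker_def to_mat_def)

lemma kronecker_power_to_mat_index:
  fixes M :: "real ^ 'n ^ 'n"
  assumes "i < CARD('n) ^ p" "j < CARD('n) ^ p"
  shows "kronecker_power (to_mat M) p $$ (i, j) = kron_entry M p i j"
  using assms
proof (induction p arbitrary: i j)
  case (Suc p)
  have "i div CARD('n) < CARD('n) ^ p" "j div CARD('n) < CARD('n) ^ p"
    using Suc.prems by (auto simp: less_mult_imp_div_less mult.commute)
  then show ?case
    using Suc dim_kronecker_power_to_mat[of M p]
    by (simp add: kronecker_def to_mat_def mult.commute)
qed simp

text \<open>Cutting the range into blocks of length \<open>n\<close> makes quotient and remainder
  independent summation indices; this peels one factor off a sum over a tensor index.\<close>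

lemma sum_lessThan_mult_div_mod:
  fixes g h :: "nat \<Rightarrow> 'a :: comm_semiring_1"
  assumes "n > 0"
  shows "(\<Sum>i<a * n. g (i div n) * h (i mod n)) = (\<Sum>i<a. g i) * (\<Sum>i<n. h i)"
proof -
  have "(\<Sum>i<a * n. g (i div n) * h (i mod n))
      = (\<Sum>m<a. \<Sum>i\<in>{m * n..<m * n + n}. g (i div n) * h (i mod n))"
    by (rule sum.nat_group[symmetric])
  also have "\<dots> = (\<Sum>m<a. \<Sum>i<n. g m * h i)"
  proof (rule sum.cong[OF refl])
    fix m
    have "(\<Sum>i\<in>{m * n..<m * n + n}. g (i div n) * h (i mod n))
        = (\<Sum>i\<in>{0..<n}. g ((i + m * n) div n) * h ((i + m * n) mod n))"
      using sum.shift_bounds_nat_ivl[of "\<lambda>i. g (i div n) * h (i mod n)" 0 "m * n" n]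
      by (simp add: add.commute)
    also have "\<dots> = (\<Sum>i<n. g m * h i)"
      using assms by (intro sum.cong) auto
    finally show "(\<Sum>i\<in>{m * n..<m * n + n}. g (i div n) * h (i mod n)) = (\<Sum>i<n. g m * h i)" .
  qed
  finally show ?thesis
    by (simp add: sum_product)
qed

lemma sum_from_nat_into_UNIV:
  "(\<Sum>i<CARD('n). h (from_nat_into UNIV i)) = (\<Sum>x\<in>(UNIV :: 'n :: finite set). h x)"
  by (intro sum.reindex_bij_betw bij_betw_from_nat_into_finite) simp

text \<open>The mixed-product rule for Kronecker powers: summing over the lowest digit of
  \<open>j\<close> separately produces one matrix-vector product per tensor factor.\<close>

lemma kron_entry_tensor:
  fixes M :: "real ^ 'n ^ 'n"
  shows "(\<Sum>j<CARD('n) ^ p. kron_entry M p i j * tensor f p j) = tensor (\<lambda>q. M *v f q) p i"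
proof (induction p arbitrary: i)
  case (Suc p)
  let ?n = "CARD('n)" and ?e = "from_nat_into UNIV :: nat \<Rightarrow> 'n"
  have "(\<Sum>j<?n ^ Suc p. kron_entry M (Suc p) i j * tensor f (Suc p) j) =
     (\<Sum>j<?n ^ p * ?n. (kron_entry M p (i div ?n) (j div ?n) * tensor f p (j div ?n)) *
       (M $ ?e (i mod ?n) $ ?e (j mod ?n) * f p $ ?e (j mod ?n)))"
    by (intro sum.cong) (auto simp: mult_ac)
  also have "\<dots> = tensor (\<lambda>q. M *v f q) p (i div ?n) * (M *v f p) $ ?e (i mod ?n)"
    by (subst sum_lessThan_mult_div_mod[where
          g = "\<lambda>j. kron_entry M p (i div ?n) j * tensor f p j" and
          h = "\<lambda>j. M $ ?e (i mod ?n) $ ?e j * f p $ ?e j"])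
      (simp_all add: Suc sum_from_nat_into_UNIV[where h = "\<lambda>x. M $ ?e (i mod ?n) $ x * f p $ x"]
        matrix_vector_mult_def)
  finally show ?case by simp
qed simp

text \<open>Transposing every factor transposes the Kronecker power, so the rule for column vectors
  carries over to row vectors.\<close>

lemma tensor_kron_entry:
  fixes M :: "real ^ 'n ^ 'n"
  shows "(\<Sum>i<CARD('n) ^ p. tensor f p i * kron_entry M p i j) = tensor (\<lambda>q. f q v* M) p j"
proof -
  have tr: "kron_entry M p i j = kron_entry (transpose M) p j i" for i
    by (induction p arbitrary: i j) (auto simp: transpose_def)
  show ?thesis
    using kron_entry_tensor[where M = "transpose M" and i = j and f = f and p = p]
    by (simp add: tr mult.commute)
qed

lemma tensor_inner:
  fixes f g :: "nat \<Rightarrow> real ^ 'n"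
  shows "(\<Sum>i<CARD('n) ^ p. tensor f p i * tensor g p i) = (\<Prod>q<p. f q \<bullet> g q)"
proof (induction p)
  case (Suc p)
  let ?n = "CARD('n)" and ?e = "from_nat_into UNIV :: nat \<Rightarrow> 'n"
  have "(\<Sum>j<?n ^ Suc p. tensor f (Suc p) j * tensor g (Suc p) j) =
     (\<Sum>j<?n ^ p * ?n. (tensor f p (j div ?n) * tensor g p (j div ?n)) *
       (f p $ ?e (j mod ?n) * g p $ ?e (j mod ?n)))"
    by (intro sum.cong) (auto simp: mult_ac)
  also have "\<dots> = (\<Prod>q<p. f q \<bullet> g q) * (f p \<bullet> g p)"
    by (subst sum_lessThan_mult_div_mod[where
          g = "\<lambda>j. tensor f p j * tensor g p j" and h = "\<lambda>j. f p $ ?e j * g p $ ?e j"])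
      (simp_all add: Suc sum_from_nat_into_UNIV[where h = "\<lambda>x. f p $ x * g p $ x"]
        inner_vec_def)
  finally show ?case by simp
qed simp

lemma tensor_cong: "(\<And>q. q < p \<Longrightarrow> f q = g q) \<Longrightarrow> tensor f p i = tensor g p i"
  by (induction p arbitrary: i) auto

lemma tensor_scaleR: "tensor (\<lambda>q. c *\<^sub>R f q) p i = c ^ p * tensor f p i"
  by (induction p arbitrary: i) (auto simp: mult_ac)

lemma norm_axis: "norm (axis k d) = \<bar>d\<bar>" for d :: real
proof -
  have "axis k d = d *\<^sub>R axis k 1" by (vector axis_def)
  then show ?thesis by simp
qed

text \<open>A multiple of a basis tensor is decomposable: the digits of \<open>i\<close> select the
  axes. Spreading \<open>d\<close> over all factors keeps each of them on a small sphere, so basis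
  tensors can be tested with covectors from a small ball.\<close>

lemma tensor_unit_vector:
  fixes d :: real
  assumes "i < CARD('n) ^ p"
  shows "\<exists>f :: nat \<Rightarrow> real ^ 'n. (\<forall>q. norm (f q) = \<bar>d\<bar>) \<and>
    (\<forall>j<CARD('n) ^ p. tensor f p j = (if j = i then d ^ p else 0))"
  using assms
proof (induction p arbitrary: i)
  case 0
  \<comment> \<open>Without factors only the norm matters, so the coordinate of the axis is
    arbitrary.\<close>
  then show ?case
    by (intro exI[of _ "\<lambda>_. axis undefined d"]) (auto simp: norm_axis)
next
  case (Suc p)
  let ?n = "CARD('n)" and ?e = "from_nat_into UNIV :: nat \<Rightarrow> 'n"
  have "i div ?n < ?n ^ p"
    using Suc.prems by (auto simp: less_mult_imp_div_less mult.commute)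
  from Suc.IH[OF this] obtain f :: "nat \<Rightarrow> real ^ 'n" where f: "\<And>q. norm (f q) = \<bar>d\<bar>"
    "\<And>j. j < ?n ^ p \<Longrightarrow> tensor f p j = (if j = i div ?n then d ^ p else 0)"
    by blast
  define g where "g = f(p := axis (?e (i mod ?n)) d)"
  have gp: "tensor g p j = tensor f p j" for j
    by (rule tensor_cong) (auto simp: g_def)
  have "norm (g q) = \<bar>d\<bar>" for q
    using f(1) by (auto simp: g_def norm_axis)
  moreover have "tensor g (Suc p) j = (if j = i then d ^ Suc p else 0)" if "j < ?n ^ Suc p" for j
  proof -
    have "inj_on ?e {..<?n}"
      using bij_betw_from_nat_into_finite[of "UNIV :: 'n set"] by (simp add: bij_betw_def)
    then have "?e (j mod ?n) = ?e (i mod ?n) \<longleftrightarrow> j mod ?n = i mod ?n"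
      by (auto simp: inj_on_eq_iff)
    moreover have "j = i" if "j div ?n = i div ?n" "j mod ?n = i mod ?n"
    proof -
      have "j = j div ?n * ?n + j mod ?n" by simp
      also have "\<dots> = i div ?n * ?n + i mod ?n" by (simp only: that)
      finally show ?thesis by simp
    qed
    moreover have "j div ?n < ?n ^ p"
      using that by (auto simp: less_mult_imp_div_less mult.commute)
    ultimately show ?thesis
      using f(2)[of "j div ?n"] by (auto simp: gp) (auto simp: g_def axis_def)
  qed
  ultimately show ?case by blast
qed

lemma abs_tensor_le_1:
  assumes "\<And>q. norm (f q) \<le> 1"
  shows "\<bar>tensor f p i\<bar> \<le> 1"
proof (induction p arbitrary: i)
  case (Suc p)
  have "\<bar>f p $ k\<bar> \<le> 1" for k
    using component_le_norm_cart[of "f p" k] assms[of p] by linarith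
  then show ?case
    using Suc by (simp add: abs_mult mult_le_one)
qed simp

lemma abs_kron_entry_le:
  assumes "norm M \<le> B"
  shows "\<bar>kron_entry M p i j\<bar> \<le> B ^ p"
proof (induction p arbitrary: i j)
  case (Suc p)
  have "\<bar>M $ k $ l\<bar> \<le> B" for k l
    using component_le_norm_cart[of "M $ k" l] Finite_Cartesian_Product.norm_nth_le[of M k] assms
    by linarith
  moreover have "0 \<le> B" using assms norm_ge_zero order_trans by blast
  ultimately show ?case
    using Suc by (simp add: abs_mult mult_mono mult.commute[of B])
qed simp

lemma borel_measurable_kron_entry [measurable]:
  "(\<lambda>M. kron_entry M p i j) \<in> borel_measurable (borel :: (real ^ 'n ^ 'n) measure)"
proof (induction p arbitrary: i j)
  case (Suc p)
  have "(\<lambda>M :: real ^ 'n ^ 'n. M $ k $ l) \<in> borel_measurable borel" for k l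
    by (intro borel_measurable_continuous_onI continuous_intros)
  then show ?case using Suc by simp
qed simp

section \<open>Growth of the powers of a matrix\<close>

lemma mat_power_smult:
  fixes A :: "'a :: comm_ring_1 Matrix.mat"
  assumes A: "A \<in> carrier_mat n n"
  shows "(c \<cdot>\<^sub>m A) ^\<^sub>m k = c ^ k \<cdot>\<^sub>m (A ^\<^sub>m k)"
proof (induction k)
  case 0 then show ?case using A by (intro eq_matI) auto
next
  case (Suc k)
  have "A ^\<^sub>m k \<in> carrier_mat n n" using A by simp
  then show ?case using A Suc
    by (simp add: mult_smult_assoc_mat[of _ n n _ n] mult_smult_distrib[of _ n n _ n])
       (intro eq_matI, auto simp: mult_ac)
qed

text \<open>After division by \<open>q\<close> the spectral radius is below 1, and the Jordan normal
  form bounds the entries of all powers of such a matrix by one constant.\<close>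

lemma spectral_radius_less_imp_power_bound:
  fixes A :: "real Matrix.mat"
  assumes A: "A \<in> carrier_mat n n" and n: "n > 0"
    and q: "spectral_radius (map_mat complex_of_real A) < q"
  shows "\<exists>C \<ge> 0. \<forall>k. \<forall>i<n. \<forall>j<n. \<bar>(A ^\<^sub>m k) $$ (i, j)\<bar> \<le> C * q ^ k"
proof -
  let ?A = "map_mat complex_of_real A"
  let ?B = "complex_of_real (1 / q) \<cdot>\<^sub>m ?A"
  have cA: "?A \<in> carrier_mat n n" and cB: "?B \<in> carrier_mat n n" using A by auto
  obtain k0 where "k0 \<in> spectrum ?A" "norm k0 = spectral_radius ?A"
    using spectral_radius_mem_max(1)[OF cA n] by auto
  then have q0: "q > 0" using q norm_ge_zero[of k0] by linarith
  have "norm l < 1" if l: "l \<in> spectrum ?B" for l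
  proof -
    obtain v where v: "v \<in> carrier_vec n" "v \<noteq> 0\<^sub>v n" "?B *\<^sub>v v = l \<cdot>\<^sub>v v"
      using l cB by (auto simp: spectrum_def eigenvalue_def eigenvector_def)
    \<comment> \<open>An eigenvalue \<open>l\<close> of the scaled matrix comes from the eigenvalue
      \<open>q * l\<close> of \<open>?A\<close>.\<close>
    have "?A *\<^sub>v v = (complex_of_real q * l) \<cdot>\<^sub>v v"
    proof (rule eq_vecI)
      fix i assume "i < dim_vec ((complex_of_real q * l) \<cdot>\<^sub>v v)"
      then have i: "i < n" using v(1) by simp
      have "vec_index (?B *\<^sub>v v) i = complex_of_real (1 / q) * vec_index (?A *\<^sub>v v) i"
        using i A v(1) by (simp add: scalar_prod_def sum_distrib_left mult_ac)
      then have "vec_index (?A *\<^sub>v v) i = complex_of_real q * vec_index (?B *\<^sub>v v) i"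
        using q0 by simp
      then show "vec_index (?A *\<^sub>v v) i = vec_index ((complex_of_real q * l) \<cdot>\<^sub>v v) i"
        unfolding v(3) using i v(1) by simp
    qed (use A v in auto)
    then have "complex_of_real q * l \<in> spectrum ?A"
      using v cA A by (auto simp: spectrum_def eigenvalue_def eigenvector_def)
    then have "norm (complex_of_real q * l) \<le> spectral_radius ?A"
      by (intro spectral_radius_mem_max(2)[OF cA n]) auto
    then have "q * norm l \<le> spectral_radius ?A" using q0 by (simp add: norm_mult)
    then have "q * norm l < q * 1" using q by linarith
    then show ?thesis using q0 mult_less_cancel_left_pos by blast
  qed
  then have "spectral_radius ?B < 1"
    using spectral_radius_mem_max(1)[OF cB n] by auto
  from spectral_radius_jnf_norm_bound_less_1_upper_triangular[OF cB this]
  obtain c where c: "\<And>k. norm_bound (?B ^\<^sub>m k) c" by blast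
  have "\<bar>(A ^\<^sub>m k) $$ (i, j)\<bar> \<le> c * q ^ k" if ij: "i < n" "j < n" for k i j
  proof -
    have cAk: "A ^\<^sub>m k \<in> carrier_mat n n" using A by simp
    have "?B ^\<^sub>m k = complex_of_real (1 / q) ^ k \<cdot>\<^sub>m map_mat complex_of_real (A ^\<^sub>m k)"
      using mat_power_smult[OF cA] of_real_hom.mat_hom_pow[OF A] by metis
    then have "norm ((?B ^\<^sub>m k) $$ (i, j)) = \<bar>(A ^\<^sub>m k) $$ (i, j)\<bar> / q ^ k"
      using ij carrier_matD[OF cAk] q0 by (simp add: norm_mult norm_power norm_divide power_divide)
    moreover have "norm ((?B ^\<^sub>m k) $$ (i, j)) \<le> c"
      using c[of k] cB ij unfolding norm_bound_def
      by (metis carrier_matD(1) carrier_matD(2) pow_carrier_mat)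
    ultimately have "\<bar>(A ^\<^sub>m k) $$ (i, j)\<bar> / q ^ k \<le> c" by simp
    then show ?thesis using q0 by (simp only: pos_divide_le_eq zero_less_power)
  qed
  moreover have "c * q ^ k \<le> max c 0 * q ^ k" for k
    using q0 by (intro mult_right_mono) auto
  ultimately have "\<bar>(A ^\<^sub>m k) $$ (i, j)\<bar> \<le> max c 0 * q ^ k" if "i < n" "j < n" for k i j
    using that order_trans by blast
  then show ?thesis by (intro exI[of _ "max c 0"]) auto
qed

section \<open>The joint spectral radius as an upper bound\<close>

text \<open>Here \<open>norm M\<close> is the Euclidean norm of all entries, not the operator norm;
  Cauchy-Schwarz is applied in each row.\<close>

lemma norm_matrix_vector_mult_le:
  fixes M :: "real ^ 'n ^ 'n"
  shows "norm (M *v x) \<le> norm M * norm x"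
proof -
  have "norm (M *v x) = L2_set (\<lambda>i. norm (M $ i \<bullet> x)) UNIV"
    by (simp add: norm_vec_def matrix_vector_mul_component)
  also have "\<dots> \<le> L2_set (\<lambda>i. norm (M $ i) * norm x) UNIV"
    by (intro L2_set_mono) (auto simp: Cauchy_Schwarz_ineq2)
  also have "\<dots> = L2_set (\<lambda>i. norm (M $ i)) UNIV * norm x"
    by (simp add: L2_set_left_distrib)
  finally show ?thesis by (simp add: norm_vec_def[of M])
qed

text \<open>Pairing \<open>f v* M\<close> with itself moves \<open>M\<close> to the other side, so
  the operator norm of \<open>M\<close> also bounds its action on covectors.\<close>

lemma norm_vector_matrix_mult_le:
  fixes M :: "real ^ 'n ^ 'n"
  shows "norm (f v* M) \<le> norm f * onorm ((*v) M)"
proof (cases "f v* M = 0")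
  case False
  have "norm (f v* M) * norm (f v* M) = f \<bullet> (M *v (f v* M))"
    by (metis dot_lmul_matrix power2_eq_square power2_norm_eq_inner)
  also have "\<dots> \<le> norm f * norm (M *v (f v* M))"
    by (rule norm_cauchy_schwarz)
  also have "\<dots> \<le> norm f * (onorm ((*v) M) * norm (f v* M))"
    by (intro mult_left_mono onorm matrix_vector_mul_bounded_linear) auto
  finally show ?thesis using False by (simp add: mult.assoc[symmetric])
qed (simp add: onorm_pos_le)

section \<open>Norms of products and the joint spectral radius\<close>

lemma left_product_cong:
  "(\<And>i. i \<in> {1..k} \<Longrightarrow> A i = B i) \<Longrightarrow> left_product A k = left_product B k"
  by (induction k) auto

lemma onorm_left_product_le:
  assumes "\<And>M. M \<in> \<M> \<Longrightarrow> norm M \<le> B" "0 \<le> B" "\<And>i. i \<in> {1..k} \<Longrightarrow> A i \<in> \<M>"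
  shows "onorm ((*v) (left_product A k)) \<le> B ^ k"
  using assms(3)
proof (induction k)
  case 0
  then show ?case by (intro onorm_le) auto
next
  case (Suc k)
  have "norm (left_product A (Suc k) *v x) \<le> B ^ Suc k * norm x" for x
  proof -
    have "norm (left_product A (Suc k) *v x) \<le> norm (A (Suc k)) * norm (left_product A k *v x)"
      using norm_matrix_vector_mult_le by (simp add: matrix_vector_mul_assoc[symmetric])
    also have "\<dots> \<le> B * (onorm ((*v) (left_product A k)) * norm x)"
      using assms(1,2) Suc.prems
      by (intro mult_mono onorm matrix_vector_mul_bounded_linear) auto
    also have "\<dots> \<le> B * (B ^ k * norm x)"
      using Suc assms(2) by (intro mult_left_mono mult_right_mono) auto
    finally show ?thesis by (simp add: mult.assoc)
  qed
  then show ?case by (intro onorm_le)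
qed

lemma joint_spectral_radius_lessD:
  assumes "joint_spectral_radius \<M> < ereal r"
  shows "\<exists>N. \<forall>k\<ge>N. \<forall>A. (\<forall>i\<in>{1..k}. A i \<in> \<M>) \<longrightarrow> onorm ((*v) (left_product A k)) \<le> r ^ k"
proof -
  have "\<forall>\<^sub>F k in sequentially. (SUP A \<in> {A. \<forall>i \<in> {1..k}. A i \<in> \<M>}.
       ereal (root k (max_singular_value (left_product A k)))) < ereal r"
    using assms unfolding joint_spectral_radius_def by (rule Limsup_lessD)
  then obtain N where N: "\<And>k. k \<ge> N \<Longrightarrow> (SUP A \<in> {A. \<forall>i \<in> {1..k}. A i \<in> \<M>}.
       ereal (root k (max_singular_value (left_product A k)))) < ereal r"
    by (auto simp: eventually_sequentially)
  \<comment> \<open>\<open>Suc N\<close> excludes k = 0, where \<open>root 0\<close> is constantly 0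
    and cannot be undone by a power.\<close>
  have "onorm ((*v) (left_product A k)) \<le> r ^ k"
    if k: "k \<ge> Suc N" and A: "\<forall>i\<in>{1..k}. A i \<in> \<M>" for k A
  proof -
    let ?x = "onorm ((*v) (left_product A k))"
    have x0: "0 \<le> ?x" by (intro onorm_pos_le matrix_vector_mul_bounded_linear)
    have "ereal (root k ?x) < ereal r"
      using A k unfolding max_singular_value_eq_onorm[symmetric]
      by (intro le_less_trans[OF SUP_upper N]) auto
    then have "root k ?x \<le> r" by simp
    then have "root k ?x ^ k \<le> r ^ k"
      using x0 k by (intro power_mono) auto
    then show ?thesis using x0 k by (simp add: real_root_pow_pos2)
  qed
  then show ?thesis by blast
qed

text \<open>The constant disappears in the limit because its k-th root tends to 1.\<close>

lemma joint_spectral_radius_le: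
  assumes "C > 0" "g \<ge> 0"
    and "\<And>k A. (\<And>i. i \<in> {1..k} \<Longrightarrow> A i \<in> \<M>) \<Longrightarrow>
      onorm ((*v) (left_product A k)) \<le> C * g ^ k"
  shows "joint_spectral_radius \<M> \<le> ereal g"
proof -
  have "\<forall>\<^sub>F k in sequentially. (SUP A \<in> {A. \<forall>i \<in> {1..k}. A i \<in> \<M>}.
       ereal (root k (max_singular_value (left_product A k)))) \<le> ereal (root k C * g)"
    using eventually_gt_at_top[of "0 :: nat"]
  proof eventually_elim
    case (elim k)
    have "root k (onorm ((*v) (left_product A k))) \<le> root k C * g"
      if "\<forall>i \<in> {1..k}. A i \<in> \<M>" for A
    proof -
      have "root k (onorm ((*v) (left_product A k))) \<le> root k (C * g ^ k)"
        using assms(3)[of k A] that elim by simp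
      then show ?thesis using elim assms(2) by (simp add: real_root_mult real_root_power_cancel)
    qed
    then show ?case
      by (intro SUP_least) (auto simp: max_singular_value_eq_onorm)
  qed
  then have "joint_spectral_radius \<M> \<le> limsup (\<lambda>k. ereal (root k C * g))"
    unfolding joint_spectral_radius_def by (rule Limsup_mono)
  also have "(\<lambda>k. root k C * g) \<longlonglongrightarrow> 1 * g"
    using LIMSEQ_root_const[OF assms(1)] by (intro tendsto_intros)
  then have "limsup (\<lambda>k. ereal (root k C * g)) = ereal g"
    by (intro lim_imp_Limsup) auto
  finally show ?thesis .
qed

lemma joint_spectral_radius_nonneg:
  assumes "\<M> \<noteq> {}"
  shows "0 \<le> joint_spectral_radius \<M>"
  unfolding joint_spectral_radius_def
proof (rule le_Limsup[OF sequentially_bot always_eventually], rule allI)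
  fix k
  obtain M where "M \<in> \<M>" using assms by blast
  moreover have "0 \<le> ereal (root k (max_singular_value (left_product (\<lambda>_. M) k)))"
  proof -
    have "0 \<le> onorm ((*v) (left_product (\<lambda>_. M) k))"
      by (intro onorm_pos_le matrix_vector_mul_bounded_linear)
    then show ?thesis by (cases "k = 0") (auto simp: max_singular_value_eq_onorm)
  qed
  ultimately show "0 \<le> (SUP A \<in> {A. \<forall>i \<in> {1..k}. A i \<in> \<M>}.
       ereal (root k (max_singular_value (left_product A k))))"
    by (intro SUP_upper2[of "\<lambda>_. M"]) auto
qed

section \<open>The support of a Borel measure and the mean Kronecker power\<close>

lemma open_Compl_measure_support: "open (- measure_support \<mu>)"
proof (subst open_subopen, intro ballI)
  fix x assume "x \<in> - measure_support \<mu>"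
  then obtain U where "open U" "x \<in> U" "\<not> emeasure \<mu> U > 0"
    by (auto simp: measure_support_def)
  then show "\<exists>T. open T \<and> x \<in> T \<and> T \<subseteq> - measure_support \<mu>"
    by (intro exI[of _ U]) (auto simp: measure_support_def)
qed

text \<open>The complement of the support is a union of open null sets, and by Lindelof countably
  many of them suffice.\<close>

lemma AE_measure_support:
  fixes \<mu> :: "'a :: second_countable_topology measure"
  assumes "sets \<mu> = sets borel"
  shows "AE x in \<mu>. x \<in> measure_support \<mu>"
proof -
  let ?F = "{U. open U \<and> emeasure \<mu> U = 0}"
  obtain F where F: "F \<subseteq> ?F" "countable F" "\<Union> F = \<Union> ?F"
    by (rule Lindelof[of ?F]) auto
  have "U \<in> null_sets \<mu>" if "U \<in> F" for U
    using that F(1) assms by (auto intro!: null_setsI)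
  then have "(\<Union>U\<in>F. U) \<in> null_sets \<mu>"
    using F(2) by (intro null_sets_UN') auto
  moreover have "- measure_support \<mu> \<subseteq> \<Union> ?F"
    by (auto simp: measure_support_def not_gr_zero)
  ultimately show ?thesis
    using F(3) by (intro AE_I'[of "\<Union> F"]) auto
qed

locale bounded_matrix_distribution = prob_space \<mu>
  for \<mu> :: "(real ^ 'n ^ 'n) measure" +
  assumes sets_eq [measurable_cong]: "sets \<mu> = sets borel"
    and bounded_support: "bounded (measure_support \<mu>)"
begin

lemma AE_support: "AE M in \<mu>. M \<in> measure_support \<mu>"
  by (rule AE_measure_support[OF sets_eq])

lemma compact_support: "compact (measure_support \<mu>)"
  using bounded_support open_Compl_measure_support
  by (auto simp: compact_eq_bounded_closed closed_def)

lemma support_nonempty: "measure_support \<mu> \<noteq> {}"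
  using AE_contr[OF AE_support] by auto

lemma support_bound: obtains B where "B > 0" "\<And>M. M \<in> measure_support \<mu> \<Longrightarrow> norm M \<le> B"
  using bounded_support by (auto simp: bounded_pos)

lemma integrable_kron_entry: "integrable \<mu> (\<lambda>M. kron_entry M p i j)"
proof -
  obtain B where B: "\<And>M. M \<in> measure_support \<mu> \<Longrightarrow> norm M \<le> B" using support_bound by blast
  have "AE M in \<mu>. norm (kron_entry M p i j) \<le> B ^ p"
    using AE_support by eventually_elim (auto intro: abs_kron_entry_le B)
  then show ?thesis
    by (intro integrable_const_bound) auto
qed

text \<open>The expected Kronecker power written through the law \<open>\<mu>\<close> alone, so that
  the random matrix and its probability space drop out of the argument.\<close>

definition mean_kron :: "nat \<Rightarrow> real Matrix.mat" where
  "mean_kron p = Matrix.mat (CARD('n) ^ p) (CARD('n) ^ p) (\<lambda>(i, j). \<integral>M. kron_entry M p i j \<partial>\<mu>)"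

lemma mean_kron_carrier: "mean_kron p \<in> carrier_mat (CARD('n) ^ p) (CARD('n) ^ p)"
  by (simp add: mean_kron_def)

lemma expectation_kronecker_power_eq:
  assumes "A \<in> borel_measurable P" "distr P borel A = \<mu>"
  shows "expectation_kronecker_power P A p = mean_kron p"
proof (rule eq_matI)
  fix i j assume "i < dim_row (mean_kron p)" "j < dim_col (mean_kron p)"
  then have ij: "i < CARD('n) ^ p" "j < CARD('n) ^ p" by (auto simp: mean_kron_def)
  have "(\<integral>\<omega>. kron_entry (A \<omega>) p i j \<partial>P) = (\<integral>M. kron_entry M p i j \<partial>\<mu>)"
    unfolding assms(2)[symmetric] using assms(1) by (subst integral_distr) auto
  then show "expectation_kronecker_power P A p $$ (i, j) = mean_kron p $$ (i, j)"
    using ij by (simp add: expectation_kronecker_power_def mean_kron_def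
        kronecker_power_to_mat_index)
qed (auto simp: expectation_kronecker_power_def mean_kron_def)

lemma joint_spectral_radius_finite: "joint_spectral_radius (measure_support \<mu>) < \<infinity>"
proof -
  obtain B where B: "B > 0" "\<And>M. M \<in> measure_support \<mu> \<Longrightarrow> norm M \<le> B"
    using support_bound by blast
  have "joint_spectral_radius (measure_support \<mu>) \<le> ereal B"
    using onorm_left_product_le[OF B(2)] B(1) by (intro joint_spectral_radius_le[of 1]) auto
  then show ?thesis by (rule le_less_trans) simp
qed

end

text \<open>The empty product bounds \<open>F\<close>. A uniform bound \<open>C * r ^ k\<close> on
  all products puts the ball of radius \<open>1 / C\<close> into \<open>F\<close>. Invariance holds
  because \<open>f v* M\<close> followed by a product of length \<open>k\<close> is \<open>f\<close>
  followed by a product of length \<open>k + 1\<close>.\<close>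

lemma exists_contracted_covectors:
  fixes \<M> :: "(real ^ 'n ^ 'n) set"
  assumes "bounded \<M>" "r > 0" "joint_spectral_radius \<M> < ereal r"
  shows "\<exists>(F :: (real ^ 'n) set) d. d > 0 \<and> cball 0 d \<subseteq> F \<and> F \<subseteq> cball 0 1 \<and>
    (\<forall>f\<in>F. \<forall>M\<in>\<M>. (1 / r) *\<^sub>R (f v* M) \<in> F)"
proof -
  define F :: "(real ^ 'n) set" where
    "F = {f. \<forall>k A. (\<forall>i\<in>{1..k}. A i \<in> \<M>) \<longrightarrow> norm (f v* left_product A k) \<le> r ^ k}"
  obtain B0 where B0: "\<And>M. M \<in> \<M> \<Longrightarrow> norm M \<le> B0"
    using assms(1) by (auto simp: bounded_iff)
  \<comment> \<open>The maximum ensures \<open>B / r \<ge> 1\<close>, so that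
    \<open>(B / r) ^ k\<close> increases with \<open>k\<close>.\<close>
  define B where "B = max B0 r"
  have B: "B > 0" "B \<ge> r" "\<And>M. M \<in> \<M> \<Longrightarrow> norm M \<le> B"
    using B0 assms(2) by (auto simp: B_def intro: le_max_iff_disj[THEN iffD2])
  obtain N where N: "\<And>k A. k \<ge> N \<Longrightarrow> (\<forall>i\<in>{1..k}. A i \<in> \<M>) \<Longrightarrow>
      onorm ((*v) (left_product A k)) \<le> r ^ k"
    using joint_spectral_radius_lessD[OF assms(3)] by blast
  \<comment> \<open>This factor pays for the lengths below \<open>N\<close>, where only the bound
    \<open>B ^ k\<close> is available.\<close>
  define C where "C = (B / r) ^ N"
  have C: "C \<ge> 1" unfolding C_def using B assms(2) by (intro one_le_power) simp
  have on: "onorm ((*v) (left_product A k)) \<le> C * r ^ k" if A: "\<forall>i\<in>{1..k}. A i \<in> \<M>"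
    for k and A :: "nat \<Rightarrow> real ^ 'n ^ 'n"
  proof (cases "k \<ge> N")
    case True
    have "r ^ k \<le> C * r ^ k" using C assms(2) by simp
    then show ?thesis using N[OF True A] by linarith
  next
    case False
    have "onorm ((*v) (left_product A k)) \<le> B ^ k"
      using onorm_left_product_le[OF B(3), of \<M> k A] A B(1) by auto
    also have "\<dots> = (B / r) ^ k * r ^ k" using assms(2) by (simp add: power_divide)
    also have "\<dots> \<le> C * r ^ k"
      unfolding C_def using False B assms(2) by (intro mult_right_mono power_increasing) auto
    finally show ?thesis .
  qed
  show ?thesis
  proof (intro exI[of _ F] exI[of _ "1 / C"] conjI subsetI ballI)
    show "1 / C > 0" using C by simp
    show "f \<in> F" if "f \<in> cball 0 (1 / C)" for f
      unfolding F_def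
    proof (intro CollectI allI impI)
      fix k and A :: "nat \<Rightarrow> real ^ 'n ^ 'n" assume A: "\<forall>i\<in>{1..k}. A i \<in> \<M>"
      have "norm (f v* left_product A k) \<le> norm f * onorm ((*v) (left_product A k))"
        by (rule norm_vector_matrix_mult_le)
      also have "\<dots> \<le> (1 / C) * (C * r ^ k)"
        using that on[OF A] C
        by (intro mult_mono onorm_pos_le matrix_vector_mul_bounded_linear) auto
      also have "\<dots> = r ^ k" using C by simp
      finally show "norm (f v* left_product A k) \<le> r ^ k" .
    qed
    show "f \<in> cball 0 1" if "f \<in> F" for f
    proof -
      have "\<forall>A. (\<forall>i\<in>{1..0 :: nat}. A i \<in> \<M>) \<longrightarrow> norm (f v* left_product A 0) \<le> r ^ 0"
        using that unfolding F_def by blast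
      then show ?thesis by simp
    qed
    show "(1 / r) *\<^sub>R (f v* M) \<in> F" if f: "f \<in> F" and M: "M \<in> \<M>" for f M
      unfolding F_def
    proof (intro CollectI allI impI)
      fix k and A :: "nat \<Rightarrow> real ^ 'n ^ 'n" assume A: "\<forall>i\<in>{1..k}. A i \<in> \<M>"
      \<comment> \<open>Covectors act from the left, so the matrix that meets \<open>f\<close> first
        is the leftmost factor, which has the highest index.\<close>
      let ?A = "A(Suc k := M)"
      have "left_product ?A k = left_product A k" by (intro left_product_cong) auto
      then have "f v* M v* left_product A k = f v* left_product ?A (Suc k)"
        by (simp add: vector_matrix_mul_assoc)
      moreover have "\<forall>i\<in>{1..Suc k}. ?A i \<in> \<M>" using A M by (auto simp: le_Suc_eq)
      then have "norm (f v* left_product ?A (Suc k)) \<le> r ^ Suc k"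
        using f unfolding F_def by blast
      ultimately have "norm (f v* M v* left_product A k) \<le> r * r ^ k" by simp
      moreover have "((1 / r) *\<^sub>R (f v* M)) v* left_product A k =
          (1 / r) *\<^sub>R (f v* M v* left_product A k)"
        by (rule scaleR_vector_matrix_assoc)
      ultimately show "norm (((1 / r) *\<^sub>R (f v* M)) v* left_product A k) \<le> r ^ k"
        using assms(2) by (simp only: norm_scaleR) (simp add: field_simps)
    qed
  qed
qed

section \<open>Eigenvalues of the mean Kronecker power\<close>

context bounded_matrix_distribution
begin

lemma integrable_tensor_vector_matrix: "integrable \<mu> (\<lambda>M. tensor (\<lambda>q. f q v* M) p j)"
  unfolding tensor_kron_entry[symmetric]
  by (intro Bochner_Integration.integrable_sum integrable_mult_right integrable_kron_entry)

lemma integral_tensor_vector_matrix: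
  assumes "j < CARD('n) ^ p"
  shows "(\<integral>M. tensor (\<lambda>q. f q v* M) p j \<partial>\<mu>) =
    (\<Sum>i<CARD('n) ^ p. tensor f p i * mean_kron p $$ (i, j))"
  unfolding tensor_kron_entry[symmetric] using assms
  by (simp add: integrable_kron_entry mean_kron_def)

lemma integrable_tensor_matrix_vector: "integrable \<mu> (\<lambda>M. tensor (\<lambda>q. M *v f q) p i)"
  unfolding kron_entry_tensor[symmetric]
  by (intro Bochner_Integration.integrable_sum integrable_mult_left integrable_kron_entry)

lemma integral_tensor_matrix_vector:
  assumes "i < CARD('n) ^ p"
  shows "(\<integral>M. tensor (\<lambda>q. M *v f q) p i \<partial>\<mu>) =
    (\<Sum>j<CARD('n) ^ p. mean_kron p $$ (i, j) * tensor f p j)"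
  unfolding kron_entry_tensor[symmetric] using assms
  by (simp add: integrable_kron_entry mean_kron_def)

text \<open>For an eigenvector \<open>u\<close> with eigenvalue \<open>l\<close>, the mean of
  \<open>L\<close> over the images \<open>f q v* M\<close> is \<open>l * L f\<close>, while each
  value is at most \<open>r ^ p * S\<close> in modulus. Taking the supremum over \<open>f\<close>
  gives \<open>norm l * S \<le> r ^ p * S\<close>, and \<open>S\<close> is finite and
  positive.\<close>

lemma spectral_radius_mean_kron_le:
  assumes r: "r > 0" and less: "joint_spectral_radius (measure_support \<mu>) < ereal r"
  shows "spectral_radius (map_mat complex_of_real (mean_kron p)) \<le> r ^ p"
proof -
  let ?n = "CARD('n) ^ p" and ?T = "map_mat complex_of_real (mean_kron p)"
  have cT: "?T \<in> carrier_mat ?n ?n" using mean_kron_carrier by simp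
  obtain F :: "(real ^ 'n) set" and d where d: "d > 0" "cball 0 d \<subseteq> F" and F01: "F \<subseteq> cball 0 1"
    and F: "\<forall>f\<in>F. \<forall>M\<in>measure_support \<mu>. (1 / r) *\<^sub>R (f v* M) \<in> F"
    using exists_contracted_covectors[OF bounded_support r less] by (elim exE conjE)
  have F1: "norm f \<le> 1" if "f \<in> F" for f using F01 that by auto
  obtain l where l: "eigenvalue ?T l" "spectral_radius ?T = norm l"
    using spectral_radius_mem_max(1)[OF cT] by (auto simp: spectrum_def)
  obtain u where u: "u \<in> carrier_vec ?n" "u \<noteq> 0\<^sub>v ?n" "?T *\<^sub>v u = l \<cdot>\<^sub>v u"
    using l(1) cT by (auto simp: eigenvalue_def eigenvector_def)
  have Tu: "(\<Sum>j<?n. complex_of_real (mean_kron p $$ (i, j)) * vec_index u j) = l * vec_index u i"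
    if i: "i < ?n" for i
  proof -
    have "vec_index (?T *\<^sub>v u) i = (\<Sum>j<?n. complex_of_real (mean_kron p $$ (i, j)) * vec_index u j)"
      using i u(1) mean_kron_carrier[of p]
      by (auto simp: scalar_prod_def atLeast0LessThan intro!: sum.cong)
    then show ?thesis using u i by simp
  qed
  define L where "L f = (\<Sum>i<?n. complex_of_real (tensor f p i) * vec_index u i)"
    for f :: "nat \<Rightarrow> real ^ 'n"
  define S where "S = (SUP f\<in>{f. \<forall>q. f q \<in> F}. norm (L f))"
  have "norm (L f) \<le> (\<Sum>i<?n. norm (vec_index u i))" if "\<forall>q. f q \<in> F" for f
    unfolding L_def
  proof (intro sum_norm_le)
    fix i
    have "\<bar>tensor f p i\<bar> \<le> 1" using that F1 by (intro abs_tensor_le_1) auto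
    then show "norm (complex_of_real (tensor f p i) * vec_index u i) \<le> norm (vec_index u i)"
      by (simp add: norm_mult mult_left_le_one_le)
  qed
  then have bdd: "bdd_above ((\<lambda>f. norm (L f)) ` {f. \<forall>q. f q \<in> F})"
    by (intro bdd_aboveI[of _ "\<Sum>i<?n. norm (vec_index u i)"]) auto
  have LS: "norm (L f) \<le> S" if "\<forall>q. f q \<in> F" for f
    unfolding S_def using that by (intro cSUP_upper bdd) auto
  have step: "norm l * norm (L f) \<le> r ^ p * S" if f: "\<forall>q. f q \<in> F" for f
  proof -
    let ?g = "\<lambda>M. L (\<lambda>q. f q v* M)"
    have int: "integrable \<mu> (\<lambda>M. complex_of_real (tensor (\<lambda>q. f q v* M) p j) * vec_index u j)" for j
      by (intro integrable_mult_left integrable_of_real integrable_tensor_vector_matrix)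
    have "(\<integral>M. ?g M \<partial>\<mu>) =
        (\<Sum>j<?n. complex_of_real (\<integral>M. tensor (\<lambda>q. f q v* M) p j \<partial>\<mu>) * vec_index u j)"
      unfolding L_def using int
      by (simp add: Bochner_Integration.integral_sum integrable_tensor_vector_matrix)
    also have "\<dots> = (\<Sum>j<?n. \<Sum>i<?n. complex_of_real (tensor f p i) *
        (complex_of_real (mean_kron p $$ (i, j)) * vec_index u j))"
      by (intro sum.cong) (auto simp: integral_tensor_vector_matrix sum_distrib_right mult.assoc)
    also have "\<dots> = (\<Sum>i<?n. complex_of_real (tensor f p i) *
        (\<Sum>j<?n. complex_of_real (mean_kron p $$ (i, j)) * vec_index u j))"
      by (subst sum.swap) (simp add: sum_distrib_left)
    also have "\<dots> = (\<Sum>i<?n. complex_of_real (tensor f p i) * (l * vec_index u i))"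
      by (intro sum.cong) (auto simp: Tu)
    also have "\<dots> = l * L f"
      by (simp add: L_def sum_distrib_left mult_ac)
    finally have eq: "l * L f = (\<integral>M. ?g M \<partial>\<mu>)" by simp
    have ig: "integrable \<mu> ?g"
      unfolding L_def by (intro Bochner_Integration.integrable_sum int)
    have le: "AE M in \<mu>. norm (?g M) \<le> r ^ p * S"
      using AE_support
    proof eventually_elim
      case (elim M)
      \<comment> \<open>Rescaling by \<open>1 / r\<close> brings every \<open>f q v* M\<close> back
        into \<open>F\<close>; multilinearity in \<open>p\<close> factors then yields
        \<open>r ^ p\<close>.\<close>
      let ?h = "\<lambda>q. (1 / r) *\<^sub>R (f q v* M)"
      have "?g M = L (\<lambda>q. r *\<^sub>R ?h q)" using r by simp
      also have "\<dots> = r ^ p * L ?h"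
        unfolding L_def tensor_scaleR by (simp add: sum_distrib_left mult.assoc)
      finally have "?g M = r ^ p * L ?h" .
      moreover have "norm (L ?h) \<le> S"
        using F f elim by (intro LS) auto
      ultimately show ?case using r by (simp add: norm_mult norm_power)
    qed
    have "norm l * norm (L f) = norm (\<integral>M. ?g M \<partial>\<mu>)"
      by (simp add: eq[symmetric] norm_mult)
    also have "\<dots> \<le> (\<integral>M. norm (?g M) \<partial>\<mu>)" by (rule integral_norm_bound)
    also have "\<dots> \<le> r ^ p * S" using ig le by (intro integral_le_const) auto
    finally show ?thesis .
  qed
  obtain i where i: "i < ?n" "vec_index u i \<noteq> 0"
  proof -
    have "\<exists>i<?n. vec_index u i \<noteq> 0"
    proof (rule ccontr)
      assume "\<not> ?thesis"
      then have "u = 0\<^sub>v ?n" using u(1) by (intro eq_vecI) auto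
      then show False using u(2) by simp
    qed
    then show ?thesis using that by blast
  qed
  \<comment> \<open>The ball inside \<open>F\<close> admits \<open>d ^ p\<close> times the basis
    tensor at a nonzero coordinate of \<open>u\<close>, which makes \<open>S\<close>
    positive.\<close>
  obtain f0 :: "nat \<Rightarrow> real ^ 'n" where f0: "\<And>q. norm (f0 q) = \<bar>d\<bar>"
    "\<And>j. j < ?n \<Longrightarrow> tensor f0 p j = (if j = i then d ^ p else 0)"
    using tensor_unit_vector[OF i(1), of d] by blast
  have f0F: "\<forall>q. f0 q \<in> F" using f0(1) d by auto
  have "L f0 = (\<Sum>j<?n. if j = i then d ^ p * vec_index u i else 0)"
    unfolding L_def using f0(2) by (intro sum.cong) auto
  also have "\<dots> = d ^ p * vec_index u i" using i(1) by simp
  finally have "norm (L f0) > 0" using i(2) d(1) by (simp add: norm_mult)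
  then have S0: "S > 0" using LS[OF f0F] by linarith
  have "norm l * S \<le> r ^ p * S"
  proof (cases "l = 0")
    case False
    have "S \<le> r ^ p * S / norm l"
      unfolding S_def
    proof (rule cSUP_least)
      show "{f. \<forall>q. f q \<in> F} \<noteq> {}" using f0F by blast
      fix f :: "nat \<Rightarrow> real ^ 'n" assume "f \<in> {f. \<forall>q. f q \<in> F}"
      then show "norm (L f) \<le> r ^ p * (SUP f\<in>{f. \<forall>q. f q \<in> F}. norm (L f)) / norm l"
        using step[of f] False unfolding S_def[symmetric] by (simp add: field_simps)
    qed
    then show ?thesis using False by (simp add: field_simps)
  qed (use S0 r in simp)
  then show ?thesis using S0 l(2) by simp
qed

end

section \<open>Lyapunov functions on an invariant cone\<close>

lemma proper_cone_add: "proper_cone K \<Longrightarrow> x \<in> K \<Longrightarrow> y \<in> K \<Longrightarrow> x + y \<in> K"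
  using convex_cone[of K] by (auto simp: proper_cone_def)

lemma proper_cone_scaleR: "proper_cone K \<Longrightarrow> x \<in> K \<Longrightarrow> c \<ge> 0 \<Longrightarrow> c *\<^sub>R x \<in> K"
  by (auto simp: proper_cone_def cone_def)

text \<open>The convex hull of the unit vectors of \<open>K\<close> is compact and avoids 0, so a
  hyperplane separates it strictly from 0; homogeneity extends the bound to all of
  \<open>K\<close>.\<close>

lemma proper_cone_strictly_positive_functional:
  assumes "proper_cone K"
  obtains f c where "c > 0" "\<And>x. x \<in> K \<Longrightarrow> c * norm x \<le> f \<bullet> x"
proof -
  let ?H = "convex hull (K \<inter> sphere 0 1)"
  \<comment> \<open>Pointedness enters here: two nonzero vectors of \<open>K\<close> cannot cancel.
    Hence the hull stays away from 0.\<close>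
  have "convex (K - {0})"
  proof (rule convexI)
    fix x y :: "real ^ 'a" and u v :: real
    assume x: "x \<in> K - {0}" and y: "y \<in> K - {0}" and uv: "0 \<le> u" "0 \<le> v" "u + v = 1"
    have K: "u *\<^sub>R x \<in> K" "v *\<^sub>R y \<in> K"
      using x y uv proper_cone_scaleR[OF assms] by auto
    moreover have "u *\<^sub>R x + v *\<^sub>R y \<noteq> 0"
    proof
      assume "u *\<^sub>R x + v *\<^sub>R y = 0"
      then have vy: "v *\<^sub>R y = - (u *\<^sub>R x)" by (simp add: eq_neg_iff_add_eq_0 add.commute)
      then have ux: "u *\<^sub>R x = 0" using K assms unfolding proper_cone_def by metis
      then have "v *\<^sub>R y = 0" unfolding vy by simp
      with ux show False using x y uv by auto
    qed
    ultimately show "u *\<^sub>R x + v *\<^sub>R y \<in> K - {0}"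
      using proper_cone_add[OF assms] by auto
  qed
  then have "?H \<subseteq> K - {0}" by (intro hull_minimal) auto
  moreover have "compact ?H"
    using assms by (intro compact_convex_hull closed_Int_compact) (auto simp: proper_cone_def)
  ultimately obtain f c where fc: "c > 0" "\<And>x. x \<in> ?H \<Longrightarrow> c < f \<bullet> x"
    using separating_hyperplane_closed_0[of ?H] compact_imp_closed[of ?H] convex_convex_hull
    by blast
  have "c * norm x \<le> f \<bullet> x" if "x \<in> K" for x
  proof (cases "x = 0")
    case False
    have "(1 / norm x) *\<^sub>R x \<in> K \<inter> sphere 0 1"
      using that False proper_cone_scaleR[OF assms] by simp
    then have "c < f \<bullet> ((1 / norm x) *\<^sub>R x)" by (intro fc(2) hull_inc)
    then show ?thesis using False by (simp add: field_simps)
  qed simp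
  with fc(1) show ?thesis by (rule that)
qed

text \<open>Scaling \<open>z\<close> by \<open>d / (2 * t)\<close> brings it into a ball around 0
  whose translate by \<open>e\<close> lies in \<open>K\<close>; scaling back gives
  \<open>C = 2 / d\<close>.\<close>

lemma interior_cone_order_unit:
  fixes K :: "'a :: real_normed_vector set"
  assumes "cone K" "e \<in> interior K"
  obtains C where "C > 0" "\<And>z t. norm z \<le> t \<Longrightarrow> (C * t) *\<^sub>R e + z \<in> K"
proof -
  obtain d where d: "d > 0" "ball e d \<subseteq> K"
    using assms(2) by (auto simp: mem_interior)
  have "((2 / d) * t) *\<^sub>R e + z \<in> K" if z: "norm z \<le> t" for z t
  proof (cases "t = 0")
    case True
    have "0 *\<^sub>R e \<in> K" using assms(1) d by (intro mem_cone) auto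
    with True z show ?thesis by simp
  next
    case False
    have t: "t > 0" using False z norm_ge_zero[of z] by linarith
    have "norm ((d / (2 * t)) *\<^sub>R z) < d"
    proof -
      have "norm ((d / (2 * t)) *\<^sub>R z) \<le> (d / (2 * t)) * t"
        unfolding norm_scaleR using t d z by (intro mult_mono) auto
      also have "\<dots> < d" using t d by simp
      finally show ?thesis .
    qed
    then have "e + (d / (2 * t)) *\<^sub>R z \<in> K"
      using d(2) by (intro subsetD[OF d(2)]) (simp add: dist_norm)
    then have "((2 / d) * t) *\<^sub>R (e + (d / (2 * t)) *\<^sub>R z) \<in> K"
      using assms(1) t d by (intro mem_cone) auto
    then show ?thesis using t d by (simp add: scaleR_right_distrib)
  qed
  with d(1) show ?thesis by (intro that[of "2 / d"]) auto
qed

lemma ennreal_le_divide_mult: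
  fixes x v :: ennreal
  assumes "w > 0" "b \<ge> 0" "ennreal w * x \<le> ennreal b * v"
  shows "x \<le> ennreal (1 / w * b) * v"
proof -
  have "x = ennreal (1 / w) * (ennreal w * x)"
    using assms(1) by (simp add: mult.assoc[symmetric] ennreal_mult[symmetric])
  also have "\<dots> \<le> ennreal (1 / w) * (ennreal b * v)" using assms(3) by (intro mult_left_mono) auto
  also have "\<dots> = ennreal (1 / w * b) * v"
    using assms(1,2) by (subst ennreal_mult) (auto simp: mult.assoc)
  finally show ?thesis .
qed

text \<open>The functional \<open>f\<close> is comparable with the norm on \<open>K\<close>, and the
  interior point \<open>e\<close> is an order unit: \<open>f\<close> bounds sizes from inside the
  cone, \<open>e\<close> dominates arbitrary perturbations.\<close>

locale cone_matrix_distribution = bounded_matrix_distribution \<mu>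
  for \<mu> :: "(real ^ 'n ^ 'n) measure" +
  fixes K :: "(real ^ 'n) set" and f e :: "real ^ 'n" and c :: real
  assumes cone: "proper_cone K"
    and invariant: "\<And>M x. M \<in> measure_support \<mu> \<Longrightarrow> x \<in> K \<Longrightarrow> M *v x \<in> K"
    and c_pos: "c > 0" and f_ge: "\<And>x. x \<in> K \<Longrightarrow> c * norm x \<le> f \<bullet> x"
    and e_interior: "e \<in> interior K"
begin

section \<open>Moments of random products\<close>

lemma e_in_K: "e \<in> K"
  using e_interior interior_subset by blast

lemma f_nonneg: "x \<in> K \<Longrightarrow> 0 \<le> f \<bullet> x"
  using f_ge[of x] c_pos by (meson mult_nonneg_nonneg norm_ge_zero order_trans less_imp_le)

text \<open>The p-th moment of the pairing of \<open>f\<close> with A_k ... A_1 x for independent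
  factors of law \<open>\<mu>\<close>; the recursion integrates over A_1 last. Values in
  \<open>ennreal\<close> avoid integrability conditions, and on \<open>K\<close> no negative value
  is cut off.\<close>

primrec moment :: "nat \<Rightarrow> nat \<Rightarrow> real ^ 'n \<Rightarrow> ennreal" where
  "moment p 0 x = ennreal (f \<bullet> x) ^ p"
| "moment p (Suc k) x = (\<integral>\<^sup>+M. moment p k (M *v x) \<partial>\<mu>)"

lemma measurable_mult_vec:
  assumes [measurable]: "g \<in> borel_measurable borel"
  shows "(\<lambda>M. g (M *v x)) \<in> borel_measurable \<mu>"
proof -
  have [measurable]: "(\<lambda>M :: real ^ 'n ^ 'n. M *v x) \<in> borel_measurable borel"
    unfolding matrix_vector_mult_def
    by (intro borel_measurable_continuous_onI continuous_intros)
  show ?thesis by measurable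
qed

text \<open>Joint measurability of \<open>M *v x\<close> in both variables makes the inner integral
  measurable in \<open>x\<close>.\<close>

lemma measurable_moment: "moment p k \<in> borel_measurable borel"
proof (induction k)
  case 0
  show ?case unfolding moment.simps by measurable
next
  case (Suc k)
  note [measurable] = Suc
  have "(\<lambda>z. snd z *v fst z) \<in> borel_measurable
      (borel :: ((real ^ 'n) \<times> (real ^ 'n ^ 'n)) measure)"
    unfolding matrix_vector_mult_def
    by (intro borel_measurable_continuous_onI continuous_intros)
  moreover have "sets (borel :: ((real ^ 'n) \<times> (real ^ 'n ^ 'n)) measure) = sets (borel \<Otimes>\<^sub>M \<mu>)"
    unfolding borel_prod[symmetric] using sets_eq by (intro sets_pair_measure_cong) auto
  ultimately have [measurable]: "(\<lambda>z. snd z *v fst z) \<in> borel_measurable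
      ((borel :: (real ^ 'n) measure) \<Otimes>\<^sub>M \<mu>)"
    using measurable_cong_sets by blast
  have "(\<lambda>x. \<integral>\<^sup>+M. moment p k (snd (x, M) *v fst (x, M)) \<partial>\<mu>) \<in> borel_measurable borel"
    by measurable
  then show ?case by simp
qed

text \<open>At \<open>k = 0\<close> a convex combination is at most the maximum, whose p-th power is
  at most the sum of the p-th powers. Integration preserves the estimate because support matrices
  are linear and respect the order of \<open>K\<close>.\<close>

lemma moment_le:
  assumes "x \<in> K" "y \<in> K" "z \<in> K" "a *\<^sub>R y + b *\<^sub>R z - x \<in> K"
    and "0 \<le> a" "0 \<le> b" "0 < t" "t < 1"
  shows "moment p k x \<le> ennreal (a / (1 - t)) ^ p * moment p k y +
    ennreal (b / t) ^ p * moment p k z"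
  using assms(1-4)
proof (induction k arbitrary: x y z)
  case 0
  let ?u = "(a / (1 - t)) * (f \<bullet> y)" and ?v = "(b / t) * (f \<bullet> z)"
  have "0 \<le> f \<bullet> (a *\<^sub>R y + b *\<^sub>R z - x)" using 0 by (intro f_nonneg)
  then have "f \<bullet> x \<le> (1 - t) * ?u + t * ?v"
    using assms(7,8) by (simp add: inner_diff_right inner_add_right)
  also have "\<dots> \<le> (1 - t) * max ?u ?v + t * max ?u ?v"
    using assms(7,8) by (intro add_mono mult_left_mono) auto
  finally have "f \<bullet> x \<le> max ?u ?v" by (simp add: algebra_simps)
  then have "ennreal (f \<bullet> x) ^ p \<le> ennreal (max ?u ?v) ^ p"
    by (intro power_mono ennreal_leI) auto
  also have "\<dots> \<le> ennreal ?u ^ p + ennreal ?v ^ p"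
    by (auto simp: max_def)
  also have "ennreal ?u = ennreal (a / (1 - t)) * ennreal (f \<bullet> y)"
    using assms f_nonneg 0 by (intro ennreal_mult) auto
  also have "ennreal ?v = ennreal (b / t) * ennreal (f \<bullet> z)"
    using assms f_nonneg 0 by (intro ennreal_mult) auto
  finally show ?case by (simp add: power_mult_distrib)
next
  case (Suc k)
  note [measurable] = measurable_mult_vec[OF measurable_moment]
  have "moment p (Suc k) x \<le> (\<integral>\<^sup>+M. ennreal (a / (1 - t)) ^ p * moment p k (M *v y)
      + ennreal (b / t) ^ p * moment p k (M *v z) \<partial>\<mu>)"
    unfolding moment.simps
  proof (rule nn_integral_mono_AE, use AE_support in eventually_elim)
    case (elim M)
    have "a *\<^sub>R (M *v y) + b *\<^sub>R (M *v z) - M *v x = M *v (a *\<^sub>R y + b *\<^sub>R z - x)"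
      by (simp add: matrix_vector_right_distrib matrix_vector_mult_diff_distrib
          linear_scale[OF matrix_vector_mul_linear])
    then show ?case
      using Suc.prems invariant[OF elim] by (intro Suc.IH) auto
  qed
  also have "\<dots> = ennreal (a / (1 - t)) ^ p * moment p (Suc k) y
      + ennreal (b / t) ^ p * moment p (Suc k) z"
    by (subst nn_integral_add) (auto simp: nn_integral_cmult)
  finally show ?case .
qed

text \<open>The p-th power of \<open>f \<bullet> x\<close> pairs two decomposable tensors, and each
  integration inserts a further factor \<open>mean_kron p\<close>; this ties moments to the spectral
  radius. The sign is recorded because \<open>ennreal\<close> would hide a negative sum.\<close>

lemma moment_eq:
  assumes "x \<in> K"
  shows "moment p k x = ennreal (\<Sum>i<CARD('n) ^ p. \<Sum>j<CARD('n) ^ p.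
      tensor (\<lambda>_. f) p i * (mean_kron p ^\<^sub>m k) $$ (i, j) * tensor (\<lambda>_. x) p j)" (is ?eq)
    and "0 \<le> (\<Sum>i<CARD('n) ^ p. \<Sum>j<CARD('n) ^ p.
      tensor (\<lambda>_. f) p i * (mean_kron p ^\<^sub>m k) $$ (i, j) * tensor (\<lambda>_. x) p j)" (is ?nonneg)
proof -
  let ?n = "CARD('n) ^ p" and ?T = "mean_kron p"
  let ?G = "\<lambda>k x. \<Sum>i<?n. \<Sum>j<?n. tensor (\<lambda>_. f) p i * (?T ^\<^sub>m k) $$ (i, j) * tensor (\<lambda>_. x) p j"
  have "moment p k x = ennreal (?G k x) \<and> 0 \<le> ?G k x"
    using assms
  proof (induction k arbitrary: x)
    case 0
    have "?G 0 x = (\<Sum>i<?n. tensor (\<lambda>_. f) p i * tensor (\<lambda>_. x) p i)"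
    proof (rule sum.cong[OF refl])
      fix i assume i: "i \<in> {..<?n}"
      have "(\<Sum>j<?n. tensor (\<lambda>_. f) p i * (?T ^\<^sub>m 0) $$ (i, j) * tensor (\<lambda>_. x) p j) =
          (\<Sum>j<?n. if i = j then tensor (\<lambda>_. f) p i * tensor (\<lambda>_. x) p j else 0)"
        using i mean_kron_carrier[of p] by (intro sum.cong) auto
      then show "(\<Sum>j<?n. tensor (\<lambda>_. f) p i * (?T ^\<^sub>m 0) $$ (i, j) * tensor (\<lambda>_. x) p j) =
          tensor (\<lambda>_. f) p i * tensor (\<lambda>_. x) p i"
        using i by simp
    qed
    then have "?G 0 x = (f \<bullet> x) ^ p" by (simp add: tensor_inner)
    then show ?case using f_nonneg[OF 0] by (simp add: ennreal_power)
  next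
    case (Suc k)
    have int: "integrable \<mu> (\<lambda>M. ?G k (M *v x))"
      by (intro Bochner_Integration.integrable_sum integrable_mult_right
          integrable_tensor_matrix_vector)
    have AE: "AE M in \<mu>. moment p k (M *v x) = ennreal (?G k (M *v x)) \<and> 0 \<le> ?G k (M *v x)"
      using AE_support by eventually_elim (intro Suc.IH invariant Suc.prems)
    have "moment p (Suc k) x = (\<integral>\<^sup>+M. ennreal (?G k (M *v x)) \<partial>\<mu>)"
      using AE by (simp, intro nn_integral_cong_AE) auto
    also have "\<dots> = ennreal (\<integral>M. ?G k (M *v x) \<partial>\<mu>)"
      using AE by (intro nn_integral_eq_integral int) auto
    finally have 1: "moment p (Suc k) x = ennreal (\<integral>M. ?G k (M *v x) \<partial>\<mu>)" .
    have 2: "0 \<le> (\<integral>M. ?G k (M *v x) \<partial>\<mu>)"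
      using AE by (intro integral_nonneg_AE) auto
    have "(\<integral>M. ?G k (M *v x) \<partial>\<mu>) = (\<Sum>i<?n. \<Sum>j<?n. tensor (\<lambda>_. f) p i * (?T ^\<^sub>m k) $$ (i, j) *
        (\<Sum>l<?n. ?T $$ (j, l) * tensor (\<lambda>_. x) p l))"
      by (simp add: Bochner_Integration.integral_sum Bochner_Integration.integrable_sum
          integrable_tensor_matrix_vector integral_tensor_matrix_vector)
    also have "\<dots> = (\<Sum>i<?n. \<Sum>l<?n. \<Sum>j<?n. tensor (\<lambda>_. f) p i * (?T ^\<^sub>m k) $$ (i, j) *
        (?T $$ (j, l) * tensor (\<lambda>_. x) p l))"
      by (subst sum.swap) (simp add: sum_distrib_left)
    also have "\<dots> = ?G (Suc k) x"
    proof (intro sum.cong refl)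
      fix i l assume il: "i \<in> {..<?n}" "l \<in> {..<?n}"
      have "(?T ^\<^sub>m Suc k) $$ (i, l) = (\<Sum>j<?n. (?T ^\<^sub>m k) $$ (i, j) * ?T $$ (j, l))"
        using il mean_kron_carrier[of p] pow_carrier_mat[OF mean_kron_carrier[of p], of k]
        by (auto simp: scalar_prod_def atLeast0LessThan intro!: sum.cong)
      then show "(\<Sum>j<?n. tensor (\<lambda>_. f) p i * (?T ^\<^sub>m k) $$ (i, j) *
          (?T $$ (j, l) * tensor (\<lambda>_. x) p l)) =
          tensor (\<lambda>_. f) p i * (?T ^\<^sub>m Suc k) $$ (i, l) * tensor (\<lambda>_. x) p l"
        by (simp add: sum_distrib_left sum_distrib_right mult_ac)
    qed
    finally show ?case using 1 2 by simp
  qed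
  then show ?eq ?nonneg by auto
qed

text \<open>The last clause combines monotonicity with respect to \<open>K\<close>, homogeneity of degree \<open>p\<close> and
  the estimate \<open>V (y + z) \<le> V y / (1 - t)\<^sup>p + V z / t\<^sup>p\<close>, which replaces convexity.\<close>

definition lyapunov :: "nat \<Rightarrow> real \<Rightarrow> (real ^ 'n \<Rightarrow> ennreal) \<Rightarrow> bool" where
  "lyapunov p g V \<longleftrightarrow> V \<in> borel_measurable borel \<and>
     (\<forall>x\<in>K. V x < \<infinity> \<and> ennreal (f \<bullet> x) ^ p \<le> V x \<and>
        (\<integral>\<^sup>+M. V (M *v x) \<partial>\<mu>) \<le> ennreal (g ^ p) * V x) \<and>
     (\<forall>x\<in>K. \<forall>y\<in>K. \<forall>z\<in>K. \<forall>a\<ge>0. \<forall>b\<ge>0. \<forall>t. 0 < t \<longrightarrow> t < 1 \<longrightarrow> a *\<^sub>R y + b *\<^sub>R z - x \<in> K \<longrightarrow>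
        V x \<le> ennreal (a / (1 - t)) ^ p * V y + ennreal (b / t) ^ p * V z)"

text \<open>The discounted sum \<open>V\<close> of all moments converges geometrically. Its first
  term gives the lower bound, an index shift gives the mean inequality, and the order estimate holds
  term by term.\<close>

lemma exists_lyapunov:
  assumes g: "g > 0" and rho: "spectral_radius (map_mat complex_of_real (mean_kron p)) < g ^ p"
  shows "\<exists>V. lyapunov p g V"
proof -
  let ?n = "CARD('n) ^ p" and ?T = "mean_kron p"
  define w where "w = 1 / g ^ p"
  have w: "w > 0" "ennreal (g ^ p) * ennreal w = 1"
    using g by (auto simp: w_def ennreal_mult[symmetric])
  define V where "V x = (\<Sum>k. ennreal w ^ k * moment p k x)" for x
  note [measurable] = measurable_moment measurable_mult_vec[OF measurable_moment]
  have meas: "V \<in> borel_measurable borel"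
    unfolding V_def[abs_def] by measurable
  \<comment> \<open>The intermediate rate leaves room for a convergent series: moments grow at most
    like \<open>q ^ k\<close>, and \<open>w * q < 1\<close>.\<close>
  obtain q where q: "spectral_radius (map_mat complex_of_real ?T) < q" "q < g ^ p"
    using rho dense by blast
  obtain k0 where "k0 \<in> spectrum (map_mat complex_of_real ?T)"
      "norm k0 = spectral_radius (map_mat complex_of_real ?T)"
    using spectral_radius_mem_max(1)[of "map_mat complex_of_real ?T" ?n] mean_kron_carrier by auto
  then have q0: "q > 0" using q(1) norm_ge_zero[of k0] by linarith
  obtain C where C: "C \<ge> 0" "\<And>k i j. i < ?n \<Longrightarrow> j < ?n \<Longrightarrow> \<bar>(?T ^\<^sub>m k) $$ (i, j)\<bar> \<le> C * q ^ k"
    using spectral_radius_less_imp_power_bound[OF mean_kron_carrier _ q(1)] by auto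
  have fin: "V x < \<infinity>" if x: "x \<in> K" for x
  proof -
    define D where "D = (\<Sum>i<?n. \<Sum>j<?n. \<bar>tensor (\<lambda>_. f) p i\<bar> * C * \<bar>tensor (\<lambda>_. x) p j\<bar>)"
    have D0: "D \<ge> 0" using C(1) unfolding D_def by (intro sum_nonneg) auto
    have "moment p k x \<le> ennreal (D * q ^ k)" for k
    proof -
      have "(\<Sum>i<?n. \<Sum>j<?n. tensor (\<lambda>_. f) p i * (?T ^\<^sub>m k) $$ (i, j) * tensor (\<lambda>_. x) p j)
          \<le> (\<Sum>i<?n. \<Sum>j<?n. \<bar>tensor (\<lambda>_. f) p i\<bar> * (C * q ^ k) * \<bar>tensor (\<lambda>_. x) p j\<bar>)"
      proof (intro sum_mono)
        fix i j assume ij: "i \<in> {..<?n}" "j \<in> {..<?n}"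
        have "tensor (\<lambda>_. f) p i * (?T ^\<^sub>m k) $$ (i, j) * tensor (\<lambda>_. x) p j \<le>
            \<bar>tensor (\<lambda>_. f) p i\<bar> * \<bar>(?T ^\<^sub>m k) $$ (i, j)\<bar> * \<bar>tensor (\<lambda>_. x) p j\<bar>"
          by (metis abs_ge_self abs_mult)
        also have "\<dots> \<le> \<bar>tensor (\<lambda>_. f) p i\<bar> * (C * q ^ k) * \<bar>tensor (\<lambda>_. x) p j\<bar>"
          using C(2)[of i j k] ij by (intro mult_mono) auto
        finally show "tensor (\<lambda>_. f) p i * (?T ^\<^sub>m k) $$ (i, j) * tensor (\<lambda>_. x) p j \<le>
            \<bar>tensor (\<lambda>_. f) p i\<bar> * (C * q ^ k) * \<bar>tensor (\<lambda>_. x) p j\<bar>" .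
      qed
      also have "\<dots> = D * q ^ k"
        unfolding D_def sum_distrib_right by (intro sum.cong refl) (simp add: mult_ac)
      finally show ?thesis unfolding moment_eq(1)[OF x] by (intro ennreal_leI)
    qed
    then have "V x \<le> (\<Sum>k. ennreal w ^ k * ennreal (D * q ^ k))"
      unfolding V_def by (intro suminf_le mult_left_mono) auto
    also have "\<dots> = (\<Sum>k. ennreal (D * (w * q) ^ k))"
      using w(1) q0 D0
      by (intro suminf_cong) 
        (simp add: ennreal_power ennreal_mult[symmetric] power_mult_distrib mult_ac)
    also have "\<dots> = ennreal (\<Sum>k. D * (w * q) ^ k)"
      using w q q0 D0 g
      by (intro suminf_ennreal2 summable_mult summable_geometric) (auto simp: w_def abs_mult)
    finally show ?thesis by (rule le_less_trans) simp
  qed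
  have ge: "ennreal (f \<bullet> x) ^ p \<le> V x" for x
  proof -
    have "(\<Sum>k<1. ennreal w ^ k * moment p k x) \<le> V x"
      unfolding V_def by (intro sum_le_suminf) auto
    then show ?thesis by simp
  qed
  have step: "(\<integral>\<^sup>+M. V (M *v x) \<partial>\<mu>) \<le> ennreal (g ^ p) * V x" for x
  proof -
    let ?s = "\<Sum>k. ennreal w ^ k * moment p (Suc k) x"
    have eq: "(\<integral>\<^sup>+M. V (M *v x) \<partial>\<mu>) = ?s"
      unfolding V_def by (subst nn_integral_suminf) (auto simp: nn_integral_cmult)
    \<comment> \<open>Multiplication by \<open>w\<close> shifts the index and leaves the series of
      \<open>V x\<close> without its term at k = 0.\<close>
    have "ennreal w * ?s = (\<Sum>k. ennreal w ^ Suc k * moment p (Suc k) x)"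
      unfolding ennreal_suminf_cmult[symmetric] by (simp only: power_Suc mult.assoc)
    also have "\<dots> \<le> V x"
    proof (rule suminf_le_const)
      fix m
      have "(\<Sum>k<m. ennreal w ^ Suc k * moment p (Suc k) x)
          \<le> (\<Sum>k<Suc m. ennreal w ^ k * moment p k x)"
        unfolding sum.lessThan_Suc_shift by (simp del: moment.simps power_Suc)
      also have "\<dots> \<le> V x"
        unfolding V_def by (intro sum_le_suminf) auto
      finally show "(\<Sum>k<m. ennreal w ^ Suc k * moment p (Suc k) x) \<le> V x" .
    qed simp
    finally have "ennreal (g ^ p) * (ennreal w * ?s) \<le> ennreal (g ^ p) * V x"
      by (intro mult_left_mono) auto
    moreover have "ennreal (g ^ p) * (ennreal w * ?s) = ?s"
      unfolding mult.assoc[symmetric] w(2) by simp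
    ultimately show ?thesis unfolding eq by simp
  qed
  have sub: "V x \<le> ennreal (a / (1 - t)) ^ p * V y + ennreal (b / t) ^ p * V z"
    if "x \<in> K" "y \<in> K" "z \<in> K" "a \<ge> 0" "b \<ge> 0" "0 < t" "t < 1" "a *\<^sub>R y + b *\<^sub>R z - x \<in> K"
    for x y z a b t
  proof -
    have "V x \<le> (\<Sum>k. ennreal (a / (1 - t)) ^ p * (ennreal w ^ k * moment p k y) +
        ennreal (b / t) ^ p * (ennreal w ^ k * moment p k z))"
      unfolding V_def
    proof (intro suminf_le)
      fix k
      have "ennreal w ^ k * moment p k x \<le> ennreal w ^ k *
          (ennreal (a / (1 - t)) ^ p * moment p k y + ennreal (b / t) ^ p * moment p k z)"
        using that by (intro mult_left_mono moment_le) auto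
      then show "ennreal w ^ k * moment p k x \<le>
          ennreal (a / (1 - t)) ^ p * (ennreal w ^ k * moment p k y) +
          ennreal (b / t) ^ p * (ennreal w ^ k * moment p k z)"
        by (simp add: distrib_left mult_ac)
    qed auto
    also have "\<dots> = ennreal (a / (1 - t)) ^ p * V y + ennreal (b / t) ^ p * V z"
      unfolding V_def by (subst suminf_add[symmetric]) (auto simp: ennreal_suminf_cmult)
    finally show ?thesis .
  qed
  show ?thesis
    unfolding lyapunov_def using meas fin ge step sub by (intro exI[of _ V]) auto
qed

text \<open>With \<open>?s = C * norm z\<close> both \<open>?s *\<^sub>R e + z\<close> and
  \<open>?s *\<^sub>R e - z\<close> lie in \<open>K\<close>. Hence \<open>M *v z\<close> is squeezed
  between multiples of \<open>M *v e\<close>, and \<open>f\<close> controls norms in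
  \<open>K\<close>.\<close>

lemma onorm_le_on_cone:
  obtains C where "C > 0"
    "\<And>M. (\<And>x. x \<in> K \<Longrightarrow> M *v x \<in> K) \<Longrightarrow> onorm ((*v) M) \<le> C * (f \<bullet> (M *v e))"
proof -
  obtain C where C: "C > 0" "\<And>z t. norm z \<le> t \<Longrightarrow> (C * t) *\<^sub>R e + z \<in> K"
    using interior_cone_order_unit[of K e] cone e_interior by (auto simp: proper_cone_def)
  have "onorm ((*v) M) \<le> 3 * C / c * (f \<bullet> (M *v e))"
    if M: "\<And>x. x \<in> K \<Longrightarrow> M *v x \<in> K" for M :: "real ^ 'n ^ 'n"
  proof (intro onorm_le)
    fix z :: "real ^ 'n"
    let ?s = "C * norm z" and ?a = "f \<bullet> (M *v e)"
    have s0: "?s \<ge> 0" using C(1) by simp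
    have Mz: "M *v (?s *\<^sub>R e + z) = ?s *\<^sub>R (M *v e) + M *v z"
             "M *v (?s *\<^sub>R e + - z) = ?s *\<^sub>R (M *v e) - M *v z"
      by (simp_all add: matrix_vector_right_distrib linear_neg[OF matrix_vector_mul_linear]
          linear_scale[OF matrix_vector_mul_linear] matrix_vector_mult_diff_distrib)
    have plus: "?s *\<^sub>R (M *v e) + M *v z \<in> K"
      unfolding Mz(1)[symmetric] by (intro M C(2)) simp
    have minus: "?s *\<^sub>R (M *v e) - M *v z \<in> K"
      unfolding Mz(2)[symmetric] by (intro M C(2)) simp
    have "c * norm (?s *\<^sub>R (M *v e) - M *v z) \<le> f \<bullet> (?s *\<^sub>R (M *v e) - M *v z)"
      by (rule f_ge[OF minus])
    also have "\<dots> \<le> 2 * (?s * ?a)"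
      using f_nonneg[OF plus] by (simp add: inner_diff_right inner_add_right)
    finally have 1: "c * norm (?s *\<^sub>R (M *v e) - M *v z) \<le> 2 * (?s * ?a)" .
    have "c * norm (M *v e) \<le> ?a" by (intro f_ge M e_in_K)
    then have 2: "?s * (c * norm (M *v e)) \<le> ?s * ?a" using s0 by (rule mult_left_mono)
    \<comment> \<open>Both terms of this decomposition lie in \<open>K\<close>; they contribute 1
      and 2 to the constant 3.\<close>
    have "norm (M *v z) \<le> norm (?s *\<^sub>R (M *v e)) + norm (?s *\<^sub>R (M *v e) - M *v z)"
      using norm_triangle_ineq4[of "?s *\<^sub>R (M *v e)" "?s *\<^sub>R (M *v e) - M *v z"] by simp
    then have "c * norm (M *v z) \<le> c * (norm (?s *\<^sub>R (M *v e)) + norm (?s *\<^sub>R (M *v e) - M *v z))"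
      using c_pos by simp
    also have "\<dots> = ?s * (c * norm (M *v e)) + c * norm (?s *\<^sub>R (M *v e) - M *v z)"
      using C(1) by (simp add: algebra_simps)
    also have "\<dots> \<le> 3 * (?s * ?a)" using 1 2 by linarith
    finally show "norm (M *v z) \<le> 3 * C / c * ?a * norm z"
      using c_pos by (simp add: field_simps)
  qed
  with C(1) c_pos show ?thesis by (intro that[of "3 * C / c"]) auto
qed

section \<open>From a contracted Lyapunov function to the joint spectral radius\<close>

lemma left_product_invariant:
  "(\<And>i. i \<in> {1..k} \<Longrightarrow> A i \<in> measure_support \<mu>) \<Longrightarrow> x \<in> K \<Longrightarrow> left_product A k *v x \<in> K"
  by (induction k) (auto simp: matrix_vector_mul_assoc[symmetric] intro!: invariant)

text \<open>Iterating the contraction along a product applied to \<open>e\<close> bounds the p-th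
  power of its \<open>f\<close>-value, and that value controls the operator norm. Taking p-th roots
  leaves \<open>root p C\<close> per factor.\<close>

lemma joint_spectral_radius_le_lyapunov:
  assumes V: "lyapunov p g0 V" and p: "p > 0" and C: "C > 0" and g: "g > 0"
    and contr: "\<And>M x. M \<in> measure_support \<mu> \<Longrightarrow> x \<in> K \<Longrightarrow> V (M *v x) \<le> ennreal (C * g ^ p) * V x"
  shows "joint_spectral_radius (measure_support \<mu>) \<le> ereal (root p C * g)"
proof -
  obtain B where B: "B > 0"
    "\<And>M. (\<And>x. x \<in> K \<Longrightarrow> M *v x \<in> K) \<Longrightarrow> onorm ((*v) M) \<le> B * (f \<bullet> (M *v e))"
    using onorm_le_on_cone by blast
  \<comment> \<open>Adding 1 keeps the constant positive even if \<open>V e\<close>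
    vanishes.\<close>
  define D where "D = enn2real (V e) + 1"
  have Ve: "V e < \<infinity>" using V e_in_K by (auto simp: lyapunov_def)
  then have "V e = ennreal (enn2real (V e))" by simp
  also have "\<dots> \<le> ennreal D" unfolding D_def by (intro ennreal_leI) simp
  finally have D: "D > 0" "V e \<le> ennreal D" by (simp_all add: D_def add_nonneg_pos)
  have it: "V (left_product A k *v e) \<le> ennreal ((C * g ^ p) ^ k) * V e"
    if "\<And>i. i \<in> {1..k} \<Longrightarrow> A i \<in> measure_support \<mu>" for A k
    using that
  proof (induction k)
    case (Suc k)
    have "V (left_product A (Suc k) *v e) = V (A (Suc k) *v (left_product A k *v e))"
      by (simp add: matrix_vector_mul_assoc)
    also have "\<dots> \<le> ennreal (C * g ^ p) * V (left_product A k *v e)"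
      using Suc.prems by (intro contr left_product_invariant e_in_K) auto
    also have "\<dots> \<le> ennreal (C * g ^ p) * (ennreal ((C * g ^ p) ^ k) * V e)"
      using Suc by (intro mult_left_mono) auto
    also have "\<dots> = ennreal ((C * g ^ p) ^ Suc k) * V e"
      using C g by (simp add: ennreal_mult mult.assoc)
    finally show ?case .
  qed simp
  show ?thesis
  proof (rule joint_spectral_radius_le[of "B * root p D"])
    show "B * root p D > 0" using B D p by simp
    show "root p C * g \<ge> 0" using C g p by simp
    fix k and A :: "nat \<Rightarrow> real ^ 'n ^ 'n"
    assume A: "\<And>i. i \<in> {1..k} \<Longrightarrow> A i \<in> measure_support \<mu>"
    let ?P = "left_product A k"
    have PK: "?P *v x \<in> K" if "x \<in> K" for x using left_product_invariant[OF A that] .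
    have a0: "0 \<le> f \<bullet> (?P *v e)" by (intro f_nonneg PK e_in_K)
    have "ennreal ((f \<bullet> (?P *v e)) ^ p) \<le> V (?P *v e)"
      using V PK[OF e_in_K] a0 by (auto simp: lyapunov_def ennreal_power[symmetric])
    also have "\<dots> \<le> ennreal ((C * g ^ p) ^ k) * V e" by (rule it[OF A])
    also have "\<dots> \<le> ennreal ((C * g ^ p) ^ k) * ennreal D"
      using D by (intro mult_left_mono) auto
    also have "\<dots> = ennreal ((C * g ^ p) ^ k * D)"
      using C g D by (intro ennreal_mult[symmetric]) auto
    finally have "(f \<bullet> (?P *v e)) ^ p \<le> (C * g ^ p) ^ k * D"
      using C g D by (subst (asm) ennreal_le_iff) auto
    then have "root p ((f \<bullet> (?P *v e)) ^ p) \<le> root p ((C * g ^ p) ^ k * D)"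
      using p by simp
    then have "f \<bullet> (?P *v e) \<le> (root p C * g) ^ k * root p D"
      using p g a0
      by (simp add: real_root_mult real_root_power real_root_power_cancel power_mult_distrib)
    then have "B * (f \<bullet> (?P *v e)) \<le> B * ((root p C * g) ^ k * root p D)"
      using B(1) by simp
    then show "onorm ((*v) ?P) \<le> B * root p D * (root p C * g) ^ k"
      using B(2)[of ?P] PK by (simp add: mult_ac)
  qed
qed

section \<open>Uniform contraction over the support\<close>

lemma emeasure_mult_le_nn_integral:
  assumes [measurable]: "S \<in> sets \<mu>" "G \<in> borel_measurable \<mu>"
    and le: "\<And>M. M \<in> S \<Longrightarrow> M \<in> measure_support \<mu> \<Longrightarrow> Y \<le> G M"
  shows "emeasure \<mu> S * Y \<le> (\<integral>\<^sup>+M. G M \<partial>\<mu>)"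
proof -
  have "emeasure \<mu> S * Y = (\<integral>\<^sup>+M. Y * indicator S M \<partial>\<mu>)"
    by (subst nn_integral_cmult_indicator) (auto simp: mult.commute)
  also have "\<dots> \<le> (\<integral>\<^sup>+M. G M \<partial>\<mu>)"
    using AE_support by (intro nn_integral_mono_AE)
      (auto split: split_indicator elim!: eventually_mono intro: le)
  finally show ?thesis .
qed

lemma lyapunov_measurable:
  "lyapunov p g V \<Longrightarrow> (\<lambda>M. V (M *v x)) \<in> borel_measurable \<mu>"
  by (intro measurable_mult_vec) (simp add: lyapunov_def)

text \<open>The mean of \<open>V (M *v x)\<close> is at least the contribution of a single atom,
  whose mass is at least \<open>w\<close>.\<close>

lemma lyapunov_contraction_atoms:
  assumes w: "w > 0" and atoms: "\<And>M. M \<in> measure_support \<mu> \<Longrightarrow> ennreal w \<le> emeasure \<mu> {M}"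
    and g: "0 < g" and V: "lyapunov p g V" and M: "M \<in> measure_support \<mu>" and x: "x \<in> K"
  shows "V (M *v x) \<le> ennreal (1 / w * g ^ p) * V x"
proof -
  note [measurable] = lyapunov_measurable[OF V]
  have "ennreal w * V (M *v x) \<le> emeasure \<mu> {M} * V (M *v x)"
    using atoms[OF M] by (intro mult_right_mono) auto
  also have "\<dots> \<le> (\<integral>\<^sup>+M. V (M *v x) \<partial>\<mu>)"
    by (intro emeasure_mult_le_nn_integral) (auto simp: sets_eq)
  also have "\<dots> \<le> ennreal (g ^ p) * V x" using V x by (auto simp: lyapunov_def)
  finally show ?thesis using g by (intro ennreal_le_divide_mult w) auto
qed

text \<open>By compactness finitely many balls of radius \<open>d / 2\<close> around support points
  cover the support, and a ball of radius \<open>d\<close> around \<open>M\<close> contains the one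
  in which \<open>M\<close> lies.\<close>

lemma emeasure_ball_bounded_below:
  assumes d: "d > 0"
  obtains w where "w > 0" "\<And>M. M \<in> measure_support \<mu> \<Longrightarrow> ennreal w \<le> emeasure \<mu> (ball M d)"
proof -
  obtain F where F: "F \<subseteq> measure_support \<mu>" "finite F" "measure_support \<mu> \<subseteq> (\<Union>M\<in>F. ball M (d / 2))"
    using compactE_image[OF compact_support, of "measure_support \<mu>" "\<lambda>M. ball M (d / 2)"] d
    by (metis UN_I centre_in_ball half_gt_zero open_ball subsetI)
  have F0: "F \<noteq> {}" using F(3) support_nonempty by auto
  define w where "w = Min ((\<lambda>M. measure \<mu> (ball M (d / 2))) ` F)"
  have "measure \<mu> (ball M (d / 2)) > 0" if "M \<in> F" for M
  proof -
    have "emeasure \<mu> (ball M (d / 2)) > 0"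
      using that F(1) d by (auto simp: measure_support_def)
    then show ?thesis by (simp add: emeasure_eq_measure)
  qed
  then have w0: "w > 0" using F(2) F0 by (auto simp: w_def)
  have "ennreal w \<le> emeasure \<mu> (ball M d)" if M: "M \<in> measure_support \<mu>" for M
  proof -
    obtain N where N: "N \<in> F" "M \<in> ball N (d / 2)" using F(3) M by blast
    have "w \<le> measure \<mu> (ball N (d / 2))" using N F(2) by (auto simp: w_def)
    also have "\<dots> \<le> measure \<mu> (ball M d)"
    proof (intro finite_measure_mono)
      show "ball N (d / 2) \<subseteq> ball M d"
      proof
        fix X assume "X \<in> ball N (d / 2)"
        then show "X \<in> ball M d"
          using N(2) dist_triangle[of M X N] by (simp add: dist_commute)
      qed
    qed (simp add: sets_eq)
    finally show ?thesis by (simp add: emeasure_eq_measure)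
  qed
  with w0 show ?thesis by (rule that)
qed

text \<open>Replacing \<open>M\<close> by a nearby \<open>M'\<close> costs an error along
  \<open>e\<close>. Near \<open>M0\<close> the image of \<open>x\<close> dominates a multiple of
  \<open>e\<close>, so averaging bounds \<open>V e\<close>, and with it the error, by
  \<open>V x\<close>. All radii and masses are fixed before \<open>p\<close> and
  \<open>V\<close>.\<close>

lemma lyapunov_contraction_interior:
  assumes d0: "d0 > 0" and M0: "M0 \<in> measure_support \<mu>" and c0: "c0 > 0"
    and int: "\<And>M x. M \<in> ball M0 d0 \<Longrightarrow> x \<in> K \<Longrightarrow> M *v x - (c0 * norm x) *\<^sub>R e \<in> K"
    and g: "0 < g" "g < g'"
  shows "\<exists>C>0. \<forall>p>0. \<forall>V. lyapunov p g V \<longrightarrow>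
    (\<forall>M\<in>measure_support \<mu>. \<forall>x\<in>K. V (M *v x) \<le> ennreal (C * g' ^ p) * V x)"
proof -
  \<comment> \<open>The split loses a factor \<open>1 / (1 - t)\<close> inside the p-th power; this
    \<open>t\<close> turns \<open>g\<close> into exactly \<open>g'\<close>.\<close>
  define t where "t = 1 - g / g'"
  have t: "0 < t" "t < 1" "g / (1 - t) = g'" using g by (auto simp: t_def)
  obtain B where B: "B > 0" "\<And>z s. norm z \<le> s \<Longrightarrow> (B * s) *\<^sub>R e + z \<in> K"
    using interior_cone_order_unit[of K e] cone e_interior by (auto simp: proper_cone_def)
  \<comment> \<open>With this radius the error coefficient times \<open>2 / m\<close> is 1, so no
    p-th power of a constant survives in the error.\<close>
  define d where "d = t * c0 / (2 * B)"
  have d: "d > 0" using t c0 B by (simp add: d_def)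
  obtain w where w: "w > 0" "\<And>M. M \<in> measure_support \<mu> \<Longrightarrow> ennreal w \<le> emeasure \<mu> (ball M d)"
    using emeasure_ball_bounded_below[OF d] by blast
  define w0 where "w0 = measure \<mu> (ball M0 d0)"
  have "emeasure \<mu> (ball M0 d0) > 0" using M0 d0 by (auto simp: measure_support_def)
  then have w0: "w0 > 0" "emeasure \<mu> (ball M0 d0) = ennreal w0"
    by (auto simp: w0_def emeasure_eq_measure)
  have "V (M *v x) \<le> ennreal (1 / w * (1 + 1 / w0) * g' ^ p) * V x"
    if p: "p > 0" and V: "lyapunov p g V" and M: "M \<in> measure_support \<mu>" and x: "x \<in> K"
    for p V M x
  proof (cases "x = 0")
    case True
    \<comment> \<open>Zero coefficients in the order estimate and \<open>p > 0\<close> force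
      \<open>V 0 = 0\<close>.\<close>
    have "V 0 \<le> ennreal (0 / (1 - 1 / 2)) ^ p * V e + ennreal (0 / (1 / 2)) ^ p * V e"
      using V x True e_in_K
      by (intro V[unfolded lyapunov_def, THEN conjunct2, THEN conjunct2, rule_format]) auto
    then have "V 0 = 0" using p by (simp add: power_0_left)
    with True show ?thesis by simp
  next
    case False
    note [measurable] = lyapunov_measurable[OF V]
    have sub: "V x \<le> ennreal (a / (1 - s)) ^ p * V y + ennreal (b / s) ^ p * V z"
      if "x \<in> K" "y \<in> K" "z \<in> K" "a \<ge> 0" "b \<ge> 0" "0 < s" "s < 1" "a *\<^sub>R y + b *\<^sub>R z - x \<in> K"
      for x y z a b s
      using V that by (auto simp: lyapunov_def)
    have step: "(\<integral>\<^sup>+M. V (M *v x) \<partial>\<mu>) \<le> ennreal (g ^ p) * V x"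
      using V x by (auto simp: lyapunov_def)
    define m where "m = c0 * norm x"
    have m: "m > 0" using c0 False by (simp add: m_def)
    have "emeasure \<mu> (ball M0 d0) * V e \<le> (\<integral>\<^sup>+M. ennreal (2 / m) ^ p * V (M *v x) \<partial>\<mu>)"
    proof (rule emeasure_mult_le_nn_integral)
      fix M assume M: "M \<in> ball M0 d0" "M \<in> measure_support \<mu>"
      have "(1 / m) *\<^sub>R (M *v x - m *\<^sub>R e) \<in> K"
        using int[OF M(1) x] m by (intro proper_cone_scaleR[OF cone]) (auto simp: m_def)
      then have "(1 / m) *\<^sub>R (M *v x) + 0 *\<^sub>R e - e \<in> K"
        using m by (simp add: scaleR_diff_right)
      \<comment> \<open>One comparison vector suffices, so the second coefficient is 0; the split
        parameter 1/2 costs the factor 2.\<close>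
      then have "V e \<le> ennreal ((1 / m) / (1 - 1 / 2)) ^ p * V (M *v x) +
          ennreal (0 / (1 / 2)) ^ p * V e"
        using m x e_in_K invariant[OF M(2)] by (intro sub) auto
      then show "V e \<le> ennreal (2 / m) ^ p * V (M *v x)" using p by (simp add: power_0_left)
    qed (auto simp: sets_eq)
    also have "\<dots> = ennreal (2 / m) ^ p * (\<integral>\<^sup>+M. V (M *v x) \<partial>\<mu>)"
      by (intro nn_integral_cmult) auto
    also have "\<dots> \<le> ennreal (2 / m) ^ p * (ennreal (g ^ p) * V x)"
      by (intro mult_left_mono step) auto
    finally have "ennreal w0 * V e \<le> ennreal 1 * (ennreal (2 / m) ^ p * (ennreal (g ^ p) * V x))"
      unfolding w0(2) by simp
    then have Ve: "V e \<le> ennreal (1 / w0 * 1) * (ennreal (2 / m) ^ p * (ennreal (g ^ p) * V x))"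
      using w0(1) by (intro ennreal_le_divide_mult) auto
    have "ennreal (B * (d * norm x) / t) ^ p * V e \<le>
       ennreal (B * (d * norm x) / t) ^ p *
        (ennreal (1 / w0 * 1) * (ennreal (2 / m) ^ p * (ennreal (g ^ p) * V x)))"
      by (intro mult_left_mono Ve) auto
    also have "\<dots> = ennreal (B * (d * norm x) / t * (2 / m)) ^ p *
        (ennreal (1 / w0) * ennreal (g ^ p)) * V x"
      using B(1) d t m by (subst ennreal_mult) (auto simp: power_mult_distrib mult_ac)
    also have "B * (d * norm x) / t * (2 / m) = 1"
      using B(1) t c0 False by (simp add: d_def m_def field_simps)
    also have "ennreal 1 ^ p * (ennreal (1 / w0) * ennreal (g ^ p)) * V x =
        ennreal (1 / w0 * g ^ p) * V x"
      using w0(1) g(1) by (subst ennreal_mult[of "1 / w0" "g ^ p"]) auto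
    finally have small:
      "ennreal (B * (d * norm x) / t) ^ p * V e \<le> ennreal (1 / w0 * g ^ p) * V x" .
    have "emeasure \<mu> (ball M d) * V (M *v x) \<le>
        (\<integral>\<^sup>+M'. ennreal (1 / (1 - t)) ^ p * V (M' *v x) + ennreal (1 / w0 * g ^ p) * V x \<partial>\<mu>)"
    proof (rule emeasure_mult_le_nn_integral)
      fix M' assume M': "M' \<in> ball M d" "M' \<in> measure_support \<mu>"
      have "norm (M' *v x - M *v x) \<le> norm (M' - M) * norm x"
        using norm_matrix_vector_mult_le[of "M' - M" x]
        by (simp add: matrix_vector_mult_diff_rdistrib)
      also have "\<dots> \<le> d * norm x"
        using M'(1) by (intro mult_right_mono) (auto simp: dist_norm norm_minus_commute)
      finally have "(B * (d * norm x)) *\<^sub>R e + (M' *v x - M *v x) \<in> K" by (rule B(2))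
      then have "1 *\<^sub>R (M' *v x) + (B * (d * norm x)) *\<^sub>R e - M *v x \<in> K"
        by (simp add: algebra_simps)
      \<comment> \<open>In the order of \<open>K\<close>, \<open>M *v x\<close> lies below
        \<open>M' *v x\<close> plus a small multiple of \<open>e\<close>; parameter \<open>t\<close>
        goes to the error term.\<close>
      then have "V (M *v x) \<le> ennreal (1 / (1 - t)) ^ p * V (M' *v x) +
          ennreal (B * (d * norm x) / t) ^ p * V e"
        using x M M'(2) invariant e_in_K t B(1) d by (intro sub) auto
      also have "\<dots> \<le> ennreal (1 / (1 - t)) ^ p * V (M' *v x) + ennreal (1 / w0 * g ^ p) * V x"
        by (intro add_left_mono small)
      finally show "V (M *v x) \<le> \<dots>" .
    qed (auto simp: sets_eq)
    also have "\<dots> = ennreal (1 / (1 - t)) ^ p * (\<integral>\<^sup>+M'. V (M' *v x) \<partial>\<mu>) +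
        ennreal (1 / w0 * g ^ p) * V x"
      by (subst nn_integral_add) (auto simp: nn_integral_cmult emeasure_space_1)
    also have "\<dots> \<le> ennreal (1 / (1 - t)) ^ p * (ennreal (g ^ p) * V x) +
        ennreal (1 / w0 * g ^ p) * V x"
      by (intro add_right_mono mult_left_mono step) auto
    also have "ennreal (1 / (1 - t)) ^ p * (ennreal (g ^ p) * V x) = ennreal (g' ^ p) * V x"
    proof -
      have "ennreal (1 / (1 - t)) ^ p * ennreal (g ^ p) = ennreal ((g / (1 - t)) ^ p)"
        using t(1,2) g(1)
        by (simp add: ennreal_power ennreal_mult[symmetric] power_mult_distrib[symmetric])
      then show ?thesis unfolding t(3) by (simp add: mult.assoc[symmetric])
    qed
    also have "ennreal (1 / w0 * g ^ p) * V x \<le> ennreal (1 / w0 * g' ^ p) * V x"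
      using w0(1) g by (intro mult_right_mono ennreal_leI mult_left_mono power_mono) auto
    also have "ennreal (g' ^ p) * V x + ennreal (1 / w0 * g' ^ p) * V x =
        ennreal ((1 + 1 / w0) * g' ^ p) * V x"
      using w0(1) g by (simp add: distrib_right ennreal_plus)
    finally have "emeasure \<mu> (ball M d) * V (M *v x) \<le> ennreal ((1 + 1 / w0) * g' ^ p) * V x"
      by (simp add: add_left_mono)
    moreover have "ennreal w * V (M *v x) \<le> emeasure \<mu> (ball M d) * V (M *v x)"
      using w(2)[OF M] by (intro mult_right_mono) auto
    ultimately have "ennreal w * V (M *v x) \<le> ennreal ((1 + 1 / w0) * g' ^ p) * V x"
      by (rule order_trans[rotated])
    then have "V (M *v x) \<le> ennreal (1 / w * ((1 + 1 / w0) * g' ^ p)) * V x"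
      using w(1) w0(1) g by (intro ennreal_le_divide_mult) auto
    then show ?thesis by (simp only: mult.assoc)
  qed
  moreover have "1 / w * (1 + 1 / w0) > 0" using w(1) w0(1) by (simp add: add_pos_pos)
  ultimately show ?thesis by blast
qed

text \<open>Otherwise the support lies in the frontier of the convex set of matrices preserving
  \<open>K\<close>. That frontier is Lebesgue null, and off the support \<open>\<mu>\<close>
  vanishes, so \<open>\<mu>\<^sub>a\<close> would be zero.\<close>

lemma exists_interior_support:
  assumes sets: "sets \<mu>\<^sub>a = sets borel" and ac: "absolutely_continuous lborel \<mu>\<^sub>a"
    and le: "\<And>B. B \<in> sets borel \<Longrightarrow> emeasure \<mu>\<^sub>a B \<le> emeasure \<mu> B"
    and nz: "emeasure \<mu>\<^sub>a UNIV \<noteq> 0"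
  shows "\<exists>M\<in>measure_support \<mu>. M \<in> interior {M. \<forall>x\<in>K. M *v x \<in> K}"
proof (rule ccontr)
  let ?I = "{M :: real ^ 'n ^ 'n. \<forall>x\<in>K. M *v x \<in> K}"
  assume "\<not> ?thesis"
  then have "measure_support \<mu> \<subseteq> frontier ?I"
    using invariant closure_subset[of ?I] by (auto simp: frontier_def)
  then have UN: "UNIV = frontier ?I \<union> - measure_support \<mu>" by auto
  have "convex ?I"
  proof (rule convexI)
    fix M N and u v :: real
    assume "M \<in> ?I" "N \<in> ?I" "0 \<le> u" "0 \<le> v" "u + v = 1"
    then show "u *\<^sub>R M + v *\<^sub>R N \<in> ?I"
      by (auto simp: matrix_vector_mult_add_rdistrib scaleR_matrix_vector_assoc[symmetric]
          intro!: proper_cone_add[OF cone] proper_cone_scaleR[OF cone])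
  qed
  then have "frontier ?I \<in> null_sets lebesgue"
    using negligible_convex_frontier negligible_iff_null_sets by blast
  then have "frontier ?I \<in> null_sets lborel"
    by (subst (asm) null_sets_completion_iff) auto
  then have 1: "emeasure \<mu>\<^sub>a (frontier ?I) = 0"
    using ac by (auto simp: absolutely_continuous_def)
  have S: "- measure_support \<mu> \<in> sets borel" by (intro borel_open open_Compl_measure_support)
  have "emeasure \<mu> (- measure_support \<mu>) = 0"
    using AE_support S by (subst (asm) AE_iff_measurable[of "- measure_support \<mu>"])
      (auto simp: sets_eq sets_eq_imp_space_eq[OF sets_eq])
  then have 2: "emeasure \<mu>\<^sub>a (- measure_support \<mu>) = 0" using le[OF S] by simp
  have "emeasure \<mu>\<^sub>a UNIV \<le> emeasure \<mu>\<^sub>a (frontier ?I) + emeasure \<mu>\<^sub>a (- measure_support \<mu>)"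
    by (subst UN, rule emeasure_subadditive) (use S sets in auto)
  then show False using 1 2 nz by simp
qed

text \<open>Subtracting a small multiple of the rank-one matrix \<open>J\<close>, which sends
  \<open>x\<close> to \<open>(f \<bullet> x) *\<^sub>R e\<close>, from a matrix near
  \<open>M0\<close> still leaves \<open>K\<close> invariant.\<close>

lemma interior_order_unit_bound:
  assumes "M0 \<in> interior {M. \<forall>x\<in>K. M *v x \<in> K}"
  shows "\<exists>d>0. \<exists>t>0. \<forall>M\<in>ball M0 d. \<forall>x\<in>K. M *v x - (t * norm x) *\<^sub>R e \<in> K"
proof -
  obtain r where r: "r > 0" "ball M0 r \<subseteq> {M. \<forall>x\<in>K. M *v x \<in> K}"
    using assms by (auto simp: mem_interior)
  define J :: "real ^ 'n ^ 'n" where "J = (\<chi> i j. e $ i * f $ j)"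
  have J: "J *v x = (f \<bullet> x) *\<^sub>R e" for x
    by (simp add: J_def Finite_Cartesian_Product.vec_eq_iff matrix_vector_mult_def inner_vec_def
        sum_distrib_left mult_ac)
  \<comment> \<open>The perturbation \<open>s *\<^sub>R J\<close> uses at most half of the radius
    \<open>r\<close>; the summand 1 keeps the denominator positive.\<close>
  define s where "s = r / 2 / (norm J + 1)"
  have nJ: "norm J + 1 > 0" by (simp add: add_nonneg_pos)
  have s: "s > 0" using r nJ by (simp add: s_def)
  have sJ: "s * norm J \<le> r / 2"
  proof -
    have cancel: "y / a * a = y" if "a > 0" for y a :: real using that by simp
    have "s * norm J \<le> s * (norm J + 1)" using s by (intro mult_left_mono) auto
    also have "\<dots> = r / 2" unfolding s_def by (rule cancel[OF nJ])
    finally show ?thesis .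
  qed
  have "M *v x - (s * c * norm x) *\<^sub>R e \<in> K" if M: "M \<in> ball M0 (r / 2)" and x: "x \<in> K" for M x
  proof -
    have "dist M0 (M - s *\<^sub>R J) \<le> norm (M0 - M) + norm (s *\<^sub>R J)"
      using norm_triangle_ineq[of "M0 - M" "s *\<^sub>R J"] by (simp add: dist_norm algebra_simps)
    also have "\<dots> < r" using M sJ s by (simp add: dist_norm)
    finally have "(M - s *\<^sub>R J) *v x \<in> K" using r(2) x by auto
    then have "M *v x - (s * (f \<bullet> x)) *\<^sub>R e \<in> K"
      by (simp add: matrix_vector_mult_diff_rdistrib scaleR_matrix_vector_assoc[symmetric] J)
    \<comment> \<open>Adding this vector of \<open>K\<close> lowers the subtracted multiple of
      \<open>e\<close> from \<open>f \<bullet> x\<close> to \<open>c * norm x\<close>.\<close>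
    moreover have "(s * (f \<bullet> x - c * norm x)) *\<^sub>R e \<in> K"
      using f_ge[OF x] s by (intro proper_cone_scaleR[OF cone] e_in_K) auto
    ultimately have "(M *v x - (s * (f \<bullet> x)) *\<^sub>R e) + (s * (f \<bullet> x - c * norm x)) *\<^sub>R e \<in> K"
      by (rule proper_cone_add[OF cone])
    then show ?thesis by (simp add: algebra_simps)
  qed
  moreover have "r / 2 > 0" "s * c > 0" using r(1) s c_pos by auto
  ultimately show ?thesis by blast
qed

text \<open>The constant in \<open>contr\<close> does not depend on \<open>p\<close>, so its p-th
  root tends to 1 and the lower bound becomes sharp in the limit.\<close>

lemma root_spectral_radius_tendsto:
  assumes contr: "\<And>g g'. 0 < g \<Longrightarrow> g < g' \<Longrightarrow> \<exists>C>0. \<forall>p>0. \<forall>V. lyapunov p g V \<longrightarrow>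
    (\<forall>M\<in>measure_support \<mu>. \<forall>x\<in>K. V (M *v x) \<le> ennreal (C * g' ^ p) * V x)"
  shows "(\<lambda>p. ereal (root p (spectral_radius (map_mat complex_of_real (mean_kron p)))))
    \<longlonglongrightarrow> joint_spectral_radius (measure_support \<mu>)"
proof (rule order_tendstoI)
  let ?J = "joint_spectral_radius (measure_support \<mu>)"
  let ?r = "\<lambda>p. spectral_radius (map_mat complex_of_real (mean_kron p))"
  have J0: "0 \<le> ?J" by (rule joint_spectral_radius_nonneg[OF support_nonempty])
  have r0: "0 \<le> ?r p" for p
    using spectral_radius_mem_max(1)[of "map_mat complex_of_real (mean_kron p)" "CARD('n) ^ p"]
      mean_kron_carrier[of p] by auto
  show "\<forall>\<^sub>F p in sequentially. ereal (root p (?r p)) < a" if a: "?J < a" for a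
  proof -
    obtain s where s: "?J < ereal s" "ereal s < a"
      using ereal_dense2[OF a] by blast
    have s0: "s > 0" using J0 s(1) by (metis ereal_less(2) le_less_trans)
    show ?thesis
      using eventually_gt_at_top[of 0]
    proof eventually_elim
      case (elim p)
      have "root p (?r p) \<le> root p (s ^ p)"
        using spectral_radius_mean_kron_le[OF s0 s(1)] elim by simp
      also have "\<dots> = s" using elim s0 by (intro real_root_power_cancel) auto
      finally show ?case using s(2) by (metis ereal_less_eq(3) le_less_trans)
    qed
  qed
  show "\<forall>\<^sub>F p in sequentially. a < ereal (root p (?r p))" if a: "a < ?J" for a
  proof (cases "a < 0")
    case True
    have "a < ereal (root p (?r p))" for p
    proof -
      have "0 \<le> root p (?r p)" using r0[of p] by (cases "p = 0") auto
      then show ?thesis using True by (metis ereal_less_eq(5) less_le_trans)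
    qed
    then show ?thesis by simp
  next
    case False
    obtain J where J: "?J = ereal J" "J \<ge> 0"
      using J0 joint_spectral_radius_finite by (cases ?J) auto
    obtain a' where a': "a = ereal a'" "a' \<ge> 0" "a' < J"
      using False a J by (cases a) auto
    \<comment> \<open>Two rates fit below \<open>J\<close>: \<open>g\<close> strictly exceeds the
      assumed p-th root, and \<open>g'\<close> absorbs the loss in \<open>contr\<close>.\<close>
    obtain g where g: "a' < g" "g < J" using dense a'(3) by blast
    obtain g' where g': "g < g'" "g' < J" using dense g(2) by blast
    have g0: "g > 0" using a' g by linarith
    obtain C where C: "C > 0" "\<And>p V. p > 0 \<Longrightarrow> lyapunov p g V \<Longrightarrow>
      (\<forall>M\<in>measure_support \<mu>. \<forall>x\<in>K. V (M *v x) \<le> ennreal (C * g' ^ p) * V x)"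
      using contr[OF g0 g'(1)] by blast
    have "(\<lambda>p. root p C * g') \<longlonglongrightarrow> 1 * g'"
      using LIMSEQ_root_const[OF C(1)] by (intro tendsto_intros)
    then have "\<forall>\<^sub>F p in sequentially. root p C * g' < J"
      using g'(2) by (intro order_tendstoD) auto
    then show ?thesis
      using eventually_gt_at_top[of 0]
    proof eventually_elim
      case (elim p)
      have "a' < root p (?r p)"
      proof (rule ccontr)
        assume "\<not> a' < root p (?r p)"
        then have "root p (?r p) ^ p \<le> a' ^ p"
          using r0[of p] elim by (intro power_mono) auto
        then have "?r p \<le> a' ^ p" using elim r0[of p] by simp
        also have "\<dots> < g ^ p" using elim g a' by (intro power_strict_mono) auto
        finally obtain V where V: "lyapunov p g V" using exists_lyapunov[OF g0] by blast
        have "?J \<le> ereal (root p C * g')"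
          using C(2)[OF elim(2) V] g0 g'(1)
          by (intro joint_spectral_radius_le_lyapunov[OF V elim(2) C(1)]) auto
        then show False using elim(1) J(1) by simp
      qed
      then show ?case by (simp add: a')
    qed
  qed
qed

end

section \<open>The limit formula: an interior support point or finitely many atoms\<close>

theorem theorem4p2:
  fixes \<mu> \<mu>\<^sub>a \<mu>\<^sub>s :: "(real ^ 'n ^ 'n) measure"
    and P :: "'w measure" and A :: "'w \<Rightarrow> real ^ 'n ^ 'n"
    and \<M> :: "(real ^ 'n ^ 'n) set"
  assumes "prob_space \<mu>" and "sets \<mu> = sets borel"
    and "\<M> = measure_support \<mu>" and "bounded \<M>"
    and "prob_space P" and "A \<in> borel_measurable P" and "distr P borel A = \<mu>"
    and "\<exists>K :: (real ^ 'n) set. proper_cone K \<and> (\<forall>M \<in> \<M>. (*v) M ` K \<subseteq> K)"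
    and "lebesgue_decomposition lborel \<mu> \<mu>\<^sub>a \<mu>\<^sub>s"
    and "(\<forall>B \<in> sets borel. emeasure \<mu>\<^sub>s B = 0) \<or>
      (\<exists>(N :: nat) (p :: nat \<Rightarrow> real) (M :: nat \<Rightarrow> real ^ 'n ^ 'n).
        (\<forall>i \<in> {1..N}. p i > 0) \<and>
        (\<forall>B \<in> sets borel.
          emeasure \<mu>\<^sub>s B = (\<Sum>i = 1..N. ennreal (p i) * emeasure (return borel (M i)) B)))"
  shows "(\<lambda>p. ereal (root p (spectral_radius
            (map_mat complex_of_real (expectation_kronecker_power P A p)))))
         \<longlonglongrightarrow> joint_spectral_radius \<M>"
proof -
  obtain K :: "(real ^ 'n) set" where K: "proper_cone K" "\<And>M x. M \<in> \<M> \<Longrightarrow> x \<in> K \<Longrightarrow> M *v x \<in> K"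
    using assms(8) by blast
  obtain f c where fc: "c > 0" "\<And>x. x \<in> K \<Longrightarrow> c * norm x \<le> f \<bullet> x"
    using proper_cone_strictly_positive_functional[OF K(1)] by blast
  obtain e where e: "e \<in> interior K" using K(1) by (auto simp: proper_cone_def)
  interpret prob_space \<mu> by fact
  interpret cone_matrix_distribution \<mu> K f e c
    using assms(2,3,4) K fc e by unfold_locales auto
  have decomp: "sets \<mu>\<^sub>a = sets borel" "absolutely_continuous lborel \<mu>\<^sub>a"
    "\<And>B. B \<in> sets borel \<Longrightarrow> emeasure \<mu> B = emeasure \<mu>\<^sub>a B + emeasure \<mu>\<^sub>s B"
    using assms(9) by (auto simp: lebesgue_decomposition_def)
  have "\<exists>C>0. \<forall>p>0. \<forall>V. lyapunov p g V \<longrightarrow>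
    (\<forall>M\<in>measure_support \<mu>. \<forall>x\<in>K. V (M *v x) \<le> ennreal (C * g' ^ p) * V x)"
    if g: "0 < g" "g < g'" for g g'
  \<comment> \<open>A nonzero absolutely continuous part supplies an interior support point;
    otherwise \<open>\<mu>\<close> coincides with \<open>\<mu>\<^sub>s\<close> and is a finite sum
    of atoms.\<close>
  proof (cases "emeasure \<mu>\<^sub>a UNIV = 0")
    case False
    obtain M0 where M0: "M0 \<in> measure_support \<mu>" "M0 \<in> interior {M. \<forall>x\<in>K. M *v x \<in> K}"
      using exists_interior_support[OF decomp(1,2) _ False] decomp(3) by auto
    obtain d t where dt: "d > 0" "t > 0" "\<forall>M\<in>ball M0 d. \<forall>x\<in>K. M *v x - (t * norm x) *\<^sub>R e \<in> K"
      using interior_order_unit_bound[OF M0(2)] by blast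
    then show ?thesis by (intro lyapunov_contraction_interior[OF dt(1) M0(1) dt(2) _ g]) blast
  next
    case True
    have eq: "emeasure \<mu> B = emeasure \<mu>\<^sub>s B" if "B \<in> sets borel" for B
    proof -
      have "emeasure \<mu>\<^sub>a B \<le> emeasure \<mu>\<^sub>a UNIV"
        by (intro emeasure_mono) (auto simp: decomp(1))
      then show ?thesis using decomp(3)[OF that] True by simp
    qed
    have "emeasure \<mu>\<^sub>s UNIV = 1"
      using emeasure_space_1 eq[of UNIV] by (simp add: sets_eq_imp_space_eq[OF sets_eq])
    \<comment> \<open>Total mass 1 excludes a vanishing singular part.\<close>
    then have "\<not> (\<forall>B \<in> sets borel. emeasure \<mu>\<^sub>s B = 0)" by force
    then obtain N :: nat and p :: "nat \<Rightarrow> real" and M :: "nat \<Rightarrow> real ^ 'n ^ 'n"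
      where p: "\<forall>i\<in>{1..N}. p i > 0" and \<mu>\<^sub>s: "\<forall>B \<in> sets borel.
        emeasure \<mu>\<^sub>s B = (\<Sum>i = 1..N. ennreal (p i) * emeasure (return borel (M i)) B)"
      using assms(10) by blast
    have M: "emeasure \<mu> B = (\<Sum>i = 1..N. ennreal (p i) * indicator B (M i))"
      if "B \<in> sets borel" for B
      using \<mu>\<^sub>s that by (simp add: eq)
    \<comment> \<open>A finite set is closed, so its complement is an open null set and misses the
      support.\<close>
    have supp: "measure_support \<mu> \<subseteq> M ` {1..N}"
    proof
      fix X assume X: "X \<in> measure_support \<mu>"
      show "X \<in> M ` {1..N}"
      proof (rule ccontr)
        assume "X \<notin> M ` {1..N}"
        moreover have "open (- (M ` {1..N}))" by (intro open_Compl finite_imp_closed) auto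
        ultimately have "emeasure \<mu> (- (M ` {1..N})) > 0"
          using X by (auto simp: measure_support_def)
        moreover have "emeasure \<mu> (- (M ` {1..N})) = 0"
          using \<open>open _\<close> by (subst M) auto
        ultimately show False by simp
      qed
    qed
    define w where "w = Min (p ` {1..N})"
    have ne: "{1..N} \<noteq> {}" using supp support_nonempty by auto
    have w: "w > 0" using p ne by (simp add: w_def)
    \<comment> \<open>The matrices \<open>M i\<close> may coincide, so the mass at \<open>X\<close>
      is only bounded below by one of the weights.\<close>
    have atoms: "ennreal w \<le> emeasure \<mu> {X}" if X: "X \<in> measure_support \<mu>" for X
    proof -
      obtain i where i: "i \<in> {1..N}" "X = M i" using supp X by blast
      have "ennreal w \<le> ennreal (p i) * indicator {X} (M i)"
        using i by (auto simp: w_def intro!: ennreal_leI Min_le)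
      also have "\<dots> \<le> (\<Sum>i = 1..N. ennreal (p i) * indicator {X} (M i))"
        using i(1)
        by (intro member_le_sum[of i "{1..N}" "\<lambda>i. ennreal (p i) * indicator {X} (M i)"]) auto
      finally show ?thesis by (simp add: M)
    qed
    have "V (X *v x) \<le> ennreal (1 / w * g' ^ p) * V x"
      if "lyapunov p g V" "X \<in> measure_support \<mu>" "x \<in> K" for p V X x
    proof -
      have "V (X *v x) \<le> ennreal (1 / w * g ^ p) * V x"
        by (rule lyapunov_contraction_atoms[OF w atoms g(1) that])
      also have "\<dots> \<le> ennreal (1 / w * g' ^ p) * V x"
        using g w by (intro mult_right_mono ennreal_leI mult_left_mono power_mono) auto
      finally show ?thesis .
    qed
    then show ?thesis using w by (intro exI[of _ "1 / w"]) auto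
  qed
  then show ?thesis
    unfolding assms(3) expectation_kronecker_power_eq[OF assms(6,7)]
    by (rule root_spectral_radius_tendsto)
qed

end
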